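(* Let $\{f_k\}_{k=1}^\infty$ be a frame for $\ell^2(\mathbb N)$ with frame bounds $A,B$, let $\{e_k\}_{k=1}^\infty$ be the canonical orthonormal basis for $\ell^2(\mathbb N)$, and assume that there are constants $C,\beta>0$ such that $$|\langle e_j,f_k\rangle|\le C e^{-\beta|j-k|}\quad\text{for all } j,k\in\mathbb N.$$ Fix $\lambda>1$ and let $T,U:\ell^2(\mathbb N)\to\ell^2(\mathbb N)$ be $$T(x_1,x_2,\dots)=\lambda(x_2,x_3,\dots),\qquad U(x_1,x_2,\dots)=\lambda^{-1}(0,x_1,x_2,\dots).$$ Let $\{\alpha(k)\}_{k=1}^\infty$ be an increasing sequence of nonnegative integers such that $\alpha(1)=0$ and $\alpha(k)\ge\alpha(k-1)+k-2$ for all $k\ge2$, and let $\varphi:=\sum_{n=1}^\infty U^{\alpha(n)}f_n$ (the series converges). Then $$\|f_1-T^{\alpha(1)}\varphi\|\le\frac{\lambda}{\lambda-1}B^{1/2}\lambda^{-\alpha(2)},$$ and for every $k\in\mathbb N\setminus\{1\}$, $$\|f_k-T^{\alpha(k)}\varphi\|\le\frac{\lambda}{\lambda-1}B^{1/2}\lambda^{-[\alpha(k+1)-\alpha(k)]}+(\lambda e^{-\beta})^{\alpha(k)}\left(\frac{Ce^{-\beta}}{\sqrt{1-e^{-2\beta}}}\sum_{n=1}^{k-1}(\lambda e^{-\beta})^{-\alpha(n)}e^{\beta n}\right).$$ In particular, assume $\ln\lambda<\beta$, fix any $\epsilon\in\,]0,A[$, and choose nonnegative integers $\alpha(k)$ recursively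 such that $\alpha(1)=0$ and, for $k\ge1$, $\alpha(k+1)$ is at least the maximum of the three numbers $$\alpha(k)+k-1,\qquad \alpha(k)+\frac{(k/2+1)\ln2+\ln\frac{\lambda}{\lambda-1}+\ln\sqrt{\frac B\epsilon}}{\ln\lambda},$$ $$\frac{(k/2+3/2)\ln2+\ln\left(\sum_{n=1}^{k}(\lambda e^{-\beta})^{-\alpha(n)}e^{\beta n}\right)+\ln\left(\frac{Ce^{-\beta}}{\sqrt{1-e^{-2\beta}}}\right)-\ln\sqrt\epsilon}{\beta-\ln\lambda},$$ and, for this choice of the integers $\alpha(k)$, let $\varphi:=\sum_{n=1}^\infty U^{\alpha(n)}f_n$. Then $\|f_k-T^{\alpha(k)}\varphi\|^2\le\epsilon2^{-k}$ for all $k\in\mathbb N$. Consequently, writing $\widetilde f_k:=T^{\alpha(k)}\varphi$, the following hold: (i) $\{\widetilde f_k\}_{k=1}^\infty$ is a frame for $\ell^2(\mathbb N)$ with bounds $A(1-\sqrt{\epsilon/A})^2$ and $B(1+\sqrt{\epsilon/B})^2$, and it has the same excess as $\{f_k\}_{k=1}^\infty$; (ii) with $V,\widetilde V$ the synthesis operators and $S,\widetilde S$ the frame operators of $\{f_k\}_{k=1}^\infty$ and $\{\widetilde f_k\}_{k=1}^\infty$, respectively, $$\|V-\widetilde V\|\le\sqrt\epsilon,\quad \|S-\widetilde S\|\le\sqrt{\epsilon B}\left(2+\sqrt{\tfrac{\epsilon}{B}}\right),\quad \|S^{-1}-\widetilde S^{-1}\|\le\frac{\sqrt{\epsilon B}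\,(2+\sqrt{\epsilon/B})}{A^2(1-\sqrt{\epsilon/A})^2}.$$
   Context: A sequence $\{f_k\}_{k=1}^\infty$ in a Hilbert space $\mathcal H$ is a frame with (lower, upper) frame bounds $A,B>0$ if $A\|f\|^2\le\sum_k|\langle f,f_k\rangle|^2\le B\|f\|^2$ for all $f\in\mathcal H$. Its synthesis operator is $V:\ell^2(\mathbb N)\to\mathcal H$, $V\{c_k\}=\sum_k c_kf_k$, and its frame operator is $S=VV^*$. The excess of a frame is the supremum (in $\mathbb N_0\cup\{\infty\}$) of the numbers $n$ such that some $n$ elements can be removed leaving a frame; equivalently, it is the dimension of the kernel of the synthesis operator (finite or $\infty$). *)

theory Defs
  imports "HOL-Analysis.Analysis" "HOL-Library.Extended_Nat"
begin

section \<open>The complex Hilbert space of square-summable sequences\<close>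

text \<open>
  The index set \<open>\<nat> = {1, 2, \<dots>}\<close> of the mathematics is \<open>{1..} :: nat set\<close>.
  A sequence \<open>(x\<^sub>1, x\<^sub>2, \<dots>)\<close> of scalars is a function
  on type \<open>nat\<close> that vanishes at the unused index 0.  For sequences of vectors and of
  integers the value at 0 is arbitrary and never used.
\<close>

typedef ell2 = "{x :: nat \<Rightarrow> complex. x 0 = 0 \<and> summable (\<lambda>k. (cmod (x k))\<^sup>2)}"
  morphisms coord Abs_ell2
  by (rule exI[of _ "\<lambda>_. 0"]) simp

setup_lifting type_definition_ell2

lemma coord_0 [simp]: "coord x 0 = 0"
  using coord[of x] by simp

lemma summable_coord [simp]: "summable (\<lambda>k. (cmod (coord x k))\<^sup>2)"
  using coord[of x] by simp

lemma ell2_eqI: "(\<And>k. coord x k = coord y k) \<Longrightarrow> x = y"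
  by (metis coord_inject ext)

lemma summable_sq_add:
  fixes x y :: "nat \<Rightarrow> complex"
  assumes "summable (\<lambda>k. (cmod (x k))\<^sup>2)" "summable (\<lambda>k. (cmod (y k))\<^sup>2)"
  shows "summable (\<lambda>k. (cmod (x k + y k))\<^sup>2)"
proof (rule summable_comparison_test'[of "\<lambda>k. 2 * (cmod (x k))\<^sup>2 + 2 * (cmod (y k))\<^sup>2" 0])
  show "summable (\<lambda>k. 2 * (cmod (x k))\<^sup>2 + 2 * (cmod (y k))\<^sup>2)"
    using assms by (intro summable_add summable_mult)
  fix k :: nat
  have "(cmod (x k + y k))\<^sup>2 \<le> (cmod (x k) + cmod (y k))\<^sup>2"
    by (simp add: norm_triangle_ineq power_mono)
  also have "\<dots> \<le> 2 * (cmod (x k))\<^sup>2 + 2 * (cmod (y k))\<^sup>2"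
    using sum_squares_bound[of "cmod (x k)" "cmod (y k)"] by (simp add: power2_sum)
  finally show "norm ((cmod (x k + y k))\<^sup>2) \<le> 2 * (cmod (x k))\<^sup>2 + 2 * (cmod (y k))\<^sup>2"
    by simp
qed

lemma summable_sq_mult:
  "summable (\<lambda>k. (cmod (x k))\<^sup>2) \<Longrightarrow> summable (\<lambda>k. (cmod (c * x k))\<^sup>2)"
  by (simp add: norm_mult power_mult_distrib summable_mult)

instantiation ell2 :: ab_group_add
begin

lift_definition zero_ell2 :: ell2 is "\<lambda>_. 0" by simp

lift_definition plus_ell2 :: "ell2 \<Rightarrow> ell2 \<Rightarrow> ell2" is "\<lambda>x y k. x k + y k"
  by (auto intro: summable_sq_add)

lift_definition uminus_ell2 :: "ell2 \<Rightarrow> ell2" is "\<lambda>x k. - x k" by simp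

definition minus_ell2 :: "ell2 \<Rightarrow> ell2 \<Rightarrow> ell2" where "minus_ell2 x y = x + - y"

instance
  by standard (transfer, auto simp: minus_ell2_def algebra_simps)+

end

lift_definition cscale :: "complex \<Rightarrow> ell2 \<Rightarrow> ell2"  (infixr "*\<^sub>c" 75) is "\<lambda>c x k. c * x k"
  by (auto intro: summable_sq_mult)

text \<open>The inner product is linear in the first argument.\<close>

definition cinner :: "ell2 \<Rightarrow> ell2 \<Rightarrow> complex" where
  "cinner x y = (\<Sum>k. coord x k * cnj (coord y k))"

lemma summable_cinner: "summable (\<lambda>k. coord x k * cnj (coord y k))"
proof (rule summable_norm_cancel, rule summable_comparison_test'[of
      "\<lambda>k. (cmod (coord x k))\<^sup>2 + (cmod (coord y k))\<^sup>2" 0])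
  show "summable (\<lambda>k. (cmod (coord x k))\<^sup>2 + (cmod (coord y k))\<^sup>2)"
    by (intro summable_add summable_coord)
  fix k :: nat
  have "cmod (coord x k) * cmod (coord y k)
      \<le> 2 * cmod (coord x k) * cmod (coord y k)" by simp
  also have "\<dots> \<le> (cmod (coord x k))\<^sup>2 + (cmod (coord y k))\<^sup>2"
    by (rule sum_squares_bound)
  finally show "norm (norm (coord x k * cnj (coord y k)))
      \<le> (cmod (coord x k))\<^sup>2 + (cmod (coord y k))\<^sup>2"
    by (simp add: norm_mult)
qed

lemma coord_add [simp]: "coord (x + y) k = coord x k + coord y k"
  by (simp add: plus_ell2.rep_eq)

lemma coord_uminus [simp]: "coord (- x) k = - coord x k"
  by (simp add: uminus_ell2.rep_eq)

lemma coord_zero [simp]: "coord 0 k = 0"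
  by (simp add: zero_ell2.rep_eq)

lemma coord_cscale [simp]: "coord (c *\<^sub>c x) k = c * coord x k"
  by (simp add: cscale.rep_eq)

lemma cinner_self: "cinner x x = of_real (\<Sum>k. (cmod (coord x k))\<^sup>2)"
proof -
  have "(\<lambda>k. of_real ((cmod (coord x k))\<^sup>2) :: complex) sums of_real (\<Sum>k. (cmod (coord x k))\<^sup>2)"
    by (intro sums_of_real summable_sums summable_coord)
  then show ?thesis
    unfolding cinner_def complex_norm_square[symmetric] by (simp add: sums_iff)
qed

lemma cinner_add_left: "cinner (x + y) z = cinner x z + cinner y z"
  unfolding cinner_def
  by (subst suminf_add[OF summable_cinner summable_cinner]) (simp add: algebra_simps)

lemma cinner_cscale_left: "cinner (c *\<^sub>c x) y = c * cinner x y"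
  unfolding cinner_def
  by (subst suminf_mult[OF summable_cinner, symmetric]) (simp add: algebra_simps)

lemma cinner_commute: "cinner y x = cnj (cinner x y)"
proof -
  have "(\<lambda>k. cnj (coord x k * cnj (coord y k))) sums cnj (cinner x y)"
    unfolding cinner_def sums_cnj by (rule summable_sums[OF summable_cinner])
  then show ?thesis
    unfolding cinner_def by (simp add: sums_iff mult.commute)
qed

text \<open>
  For the library notions of norm, convergence, bounded operators etc. the type is made an
  instance of the real type classes; the real inner product is the real part of
  \<open>cinner\<close>, and both induce the same norm.
\<close>

instantiation ell2 :: real_vector
begin

definition scaleR_ell2 :: "real \<Rightarrow> ell2 \<Rightarrow> ell2" where "scaleR_ell2 r x = of_real r *\<^sub>c x"

instance
  by standard (auto intro!: ell2_eqI simp: scaleR_ell2_def algebra_simps)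

end

lemma coord_scaleR [simp]: "coord (r *\<^sub>R x) k = of_real r * coord x k"
  by (simp add: scaleR_ell2_def cscale.rep_eq)

instantiation ell2 :: real_inner
begin

definition inner_ell2 :: "ell2 \<Rightarrow> ell2 \<Rightarrow> real" where "inner_ell2 x y = Re (cinner x y)"

definition norm_ell2 :: "ell2 \<Rightarrow> real" where "norm_ell2 x = sqrt (\<Sum>k. (cmod (coord x k))\<^sup>2)"

definition sgn_ell2 :: "ell2 \<Rightarrow> ell2" where "sgn_ell2 x = x /\<^sub>R norm x"

definition dist_ell2 :: "ell2 \<Rightarrow> ell2 \<Rightarrow> real" where "dist_ell2 x y = norm (x - y)"

definition uniformity_ell2 :: "(ell2 \<times> ell2) filter" where
  "uniformity_ell2 = (INF e\<in>{0<..}. principal {(x, y). dist x y < e})"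

definition open_ell2 :: "ell2 set \<Rightarrow> bool" where
  "open_ell2 S = (\<forall>x\<in>S. \<forall>\<^sub>F (x', y) in uniformity. x' = x \<longrightarrow> y \<in> S)"

lemma inner_ell2_self: "inner x x = (\<Sum>k. (cmod (coord x k))\<^sup>2)" for x :: ell2
  by (simp add: inner_ell2_def cinner_self)

instance
proof
  fix x y z :: ell2 and r s :: real
  show "sgn x = x /\<^sub>R norm x" "dist x y = norm (x - y)"
    "uniformity = (INF e\<in>{0<..}. principal {(x :: ell2, y). dist x y < e})"
    by (simp_all add: sgn_ell2_def dist_ell2_def uniformity_ell2_def)
  show "open S = (\<forall>x\<in>S. \<forall>\<^sub>F (x', y) in uniformity. x' = x \<longrightarrow> y \<in> S)" for S :: "ell2 set"
    by (simp add: open_ell2_def)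
  show "inner x y = inner y x"
    by (simp add: inner_ell2_def cinner_commute[of x y])
  show "inner (x + y) z = inner x z + inner y z"
    by (simp add: inner_ell2_def cinner_add_left)
  show "inner (r *\<^sub>R x) y = r * inner x y"
    by (simp add: inner_ell2_def scaleR_ell2_def cinner_cscale_left)
  show "0 \<le> inner x x"
    by (simp add: inner_ell2_self suminf_nonneg)
  show "inner x x = 0 \<longleftrightarrow> x = 0"
    by (auto simp: inner_ell2_self suminf_eq_zero_iff intro: ell2_eqI)
  show "norm x = sqrt (inner x x)"
    by (simp add: norm_ell2_def inner_ell2_self)
qed

end

lemma coord_diff [simp]: "coord (x - y) k = coord x k - coord y k"
  by (metis coord_add coord_uminus diff_conv_add_uminus)

lemma norm_ell2_sq: "(norm x)\<^sup>2 = (\<Sum>k. (cmod (coord x k))\<^sup>2)" for x :: ell2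
  by (simp add: power2_norm_eq_inner inner_ell2_self)

lemma sum_coord_le_norm: "(\<Sum>k<n. (cmod (coord x k))\<^sup>2) \<le> (norm x)\<^sup>2"
  unfolding norm_ell2_sq by (rule sum_le_suminf) auto

lemma cmod_coord_le_norm: "cmod (coord x k) \<le> norm x"
proof -
  have "(cmod (coord x k))\<^sup>2 \<le> (\<Sum>k<Suc k. (cmod (coord x k))\<^sup>2)"
    by (simp add: sum_nonneg)
  also have "\<dots> \<le> (norm x)\<^sup>2" by (rule sum_coord_le_norm)
  finally show ?thesis by (simp add: power2_le_iff_abs_le)
qed

instance ell2 :: banach
proof
  fix X :: "nat \<Rightarrow> ell2"
  assume X: "Cauchy X"
  have "Cauchy (\<lambda>n. coord (X n) k)" for k
  proof (rule metric_CauchyI)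
    fix e :: real assume "0 < e"
    then obtain M where "\<forall>m\<ge>M. \<forall>n\<ge>M. dist (X m) (X n) < e"
      using metric_CauchyD[OF X] by blast
    moreover have "dist (coord (X m) k) (coord (X n) k) \<le> dist (X m) (X n)" for m n
      using cmod_coord_le_norm[of "X m - X n" k] by (simp add: dist_norm)
    ultimately show "\<exists>M. \<forall>m\<ge>M. \<forall>n\<ge>M. dist (coord (X m) k) (coord (X n) k) < e"
      by (meson order_le_less_trans)
  qed
  then have "\<exists>l. (\<lambda>n. coord (X n) k) \<longlonglongrightarrow> l" for k
    by (meson Cauchy_convergent_iff convergent_def)
  then obtain l where l: "\<And>k. (\<lambda>n. coord (X n) k) \<longlonglongrightarrow> l k"
    by metis
  have partial: "(\<Sum>k<n. (cmod (coord (X m) k - l k))\<^sup>2) \<le> e\<^sup>2"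
    if "\<forall>p\<ge>M. norm (X m - X p) \<le> e" for m n M e
  proof (rule LIMSEQ_le_const2)
    show "(\<lambda>p. \<Sum>k<n. (cmod (coord (X m) k - coord (X p) k))\<^sup>2)
        \<longlonglongrightarrow> (\<Sum>k<n. (cmod (coord (X m) k - l k))\<^sup>2)"
      by (intro tendsto_intros l)
    have "(\<Sum>k<n. (cmod (coord (X m) k - coord (X p) k))\<^sup>2) \<le> e\<^sup>2" if "p \<ge> M" for p
    proof -
      have "(\<Sum>k<n. (cmod (coord (X m) k - coord (X p) k))\<^sup>2) \<le> (norm (X m - X p))\<^sup>2"
        using sum_coord_le_norm[of "X m - X p" n] by simp
      also have "\<dots> \<le> e\<^sup>2"
        using \<open>\<forall>p\<ge>M. norm (X m - X p) \<le> e\<close> that by (simp add: power_mono)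
      finally show ?thesis .
    qed
    then show "\<exists>N. \<forall>p\<ge>N. (\<Sum>k<n. (cmod (coord (X m) k - coord (X p) k))\<^sup>2) \<le> e\<^sup>2"
      by blast
  qed
  have diff_summable: "summable (\<lambda>k. (cmod (coord (X m) k - l k))\<^sup>2)"
    if "\<forall>p\<ge>M. norm (X m - X p) \<le> e" for m M e
    by (rule summableI_nonneg_bounded[where x = "e\<^sup>2"]) (use partial[OF that] in auto)
  obtain M where M: "\<forall>m\<ge>M. \<forall>n\<ge>M. dist (X m) (X n) < 1"
    using metric_CauchyD[OF X, of 1] by auto
  then have "\<forall>p\<ge>M. norm (X M - X p) \<le> 1"
    by (metis dist_norm less_imp_le order_refl)
  from diff_summable[OF this]
  have "summable (\<lambda>k. (cmod (- 1 * (coord (X M) k - l k)))\<^sup>2)"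
    by (rule summable_sq_mult)
  from summable_sq_add[OF summable_coord[of "X M"] this]
  have "summable (\<lambda>k. (cmod (l k))\<^sup>2)" by simp
  moreover have "l 0 = 0"
    using l[of 0] by (simp add: LIMSEQ_const_iff)
  ultimately have coord_l: "coord (Abs_ell2 l) = l"
    by (simp add: Abs_ell2_inverse)
  have "X \<longlonglongrightarrow> Abs_ell2 l"
  proof (rule metric_LIMSEQ_I)
    fix r :: real assume "0 < r"
    then obtain M where M: "\<forall>m\<ge>M. \<forall>n\<ge>M. dist (X m) (X n) < r / 2"
      using metric_CauchyD[OF X, of "r / 2"] by auto
    have "dist (X m) (Abs_ell2 l) < r" if "m \<ge> M" for m
    proof -
      have *: "\<forall>p\<ge>M. norm (X m - X p) \<le> r / 2"
        using M that by (metis dist_norm less_imp_le)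
      have "(norm (X m - Abs_ell2 l))\<^sup>2 \<le> (r / 2)\<^sup>2"
        unfolding norm_ell2_sq coord_diff coord_l
        by (rule suminf_le_const[OF diff_summable[OF *] partial[OF *]])
      then have "norm (X m - Abs_ell2 l) \<le> r / 2"
        using \<open>0 < r\<close> by (simp add: power2_le_iff_abs_le)
      then show ?thesis using \<open>0 < r\<close> by (simp add: dist_norm)
    qed
    then show "\<exists>M. \<forall>m\<ge>M. dist (X m) (Abs_ell2 l) < r" by blast
  qed
  then show "convergent X" by (auto simp: convergent_def)
qed

text \<open>The canonical orthonormal basis is \<open>ell2_basis 1, ell2_basis 2, \<dots>\<close>.\<close>

lift_definition ell2_basis :: "nat \<Rightarrow> ell2" is "\<lambda>j k. if 1 \<le> k \<and> k = j then 1 else 0"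
proof
  fix j :: nat
  show "summable (\<lambda>k. (cmod (if 1 \<le> k \<and> k = j then 1 else 0))\<^sup>2)"
    by (rule summable_finite[of "{j}"]) auto
qed simp

section \<open>Weighted shifts\<close>

text \<open>\<open>(x\<^sub>1, x\<^sub>2, \<dots>) \<mapsto> c (x\<^sub>2, x\<^sub>3, \<dots>)\<close>\<close>

lift_definition left_shift :: "real \<Rightarrow> ell2 \<Rightarrow> ell2" is
  "\<lambda>c x k. if k = 0 then 0 else of_real c * x (Suc k)"
proof
  fix c :: real and x :: "nat \<Rightarrow> complex"
  assume "x 0 = 0 \<and> summable (\<lambda>k. (cmod (x k))\<^sup>2)"
  then have "summable (\<lambda>k. (cmod (of_real c * x (Suc k)))\<^sup>2)"
    using summable_Suc_iff[of "\<lambda>k. (cmod (x k))\<^sup>2"] by (intro summable_sq_mult) blast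
  then show "summable (\<lambda>k. (cmod (if k = 0 then 0 else of_real c * x (Suc k)))\<^sup>2)"
    by (rule summable_comparison_test'[where N = 0]) auto
qed simp

text \<open>\<open>(x\<^sub>1, x\<^sub>2, \<dots>) \<mapsto> c (0, x\<^sub>1, x\<^sub>2, \<dots>)\<close>; since \<open>x 0 = 0\<close>, coordinate 1 of the image is 0.\<close>

lift_definition right_shift :: "real \<Rightarrow> ell2 \<Rightarrow> ell2" is
  "\<lambda>c x k. if k = 0 then 0 else of_real c * x (k - 1)"
proof
  fix c :: real and x :: "nat \<Rightarrow> complex"
  assume "x 0 = 0 \<and> summable (\<lambda>k. (cmod (x k))\<^sup>2)"
  then have "summable (\<lambda>k. (cmod (of_real c * x k))\<^sup>2)"
    by (intro summable_sq_mult) simp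
  then have "summable (\<lambda>k. (cmod (if Suc k = 0 then 0 else of_real c * x (Suc k - 1)))\<^sup>2)"
    by simp
  then show "summable (\<lambda>k. (cmod (if k = 0 then 0 else of_real c * x (k - 1)))\<^sup>2)"
    by (subst summable_Suc_iff[symmetric])
qed simp

section \<open>Frames\<close>

text \<open>
  The family \<open>(f k)\<close>, \<open>k \<in> I\<close>, is a frame with (lower, upper) bounds \<open>A\<close>, \<open>B\<close>.
  Convergence of the middle sum is required explicitly because \<open>infsum\<close> is 0 on
  non-summable families.
\<close>

definition frame_with_bounds :: "nat set \<Rightarrow> (nat \<Rightarrow> ell2) \<Rightarrow> real \<Rightarrow> real \<Rightarrow> bool" where
  "frame_with_bounds I f A B \<longleftrightarrow> 0 < A \<and> 0 < B \<and>
    (\<forall>x. (\<lambda>k. (cmod (cinner x (f k)))\<^sup>2) summable_on I \<and>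
         A * (norm x)\<^sup>2 \<le> (\<Sum>\<^sub>\<infinity>k\<in>I. (cmod (cinner x (f k)))\<^sup>2) \<and>
         (\<Sum>\<^sub>\<infinity>k\<in>I. (cmod (cinner x (f k)))\<^sup>2) \<le> B * (norm x)\<^sup>2)"

definition is_frame :: "nat set \<Rightarrow> (nat \<Rightarrow> ell2) \<Rightarrow> bool" where
  "is_frame I f \<longleftrightarrow> (\<exists>A B. frame_with_bounds I f A B)"

text \<open>
  The excess of \<open>f 1, f 2, \<dots>\<close>: the supremum of all \<open>n\<close> such that some \<open>n\<close> elements (counted
  by index) can be removed leaving a frame.
\<close>

definition excess :: "(nat \<Rightarrow> ell2) \<Rightarrow> enat" where
  "excess f = Sup {enat (card J) | J. finite J \<and> J \<subseteq> {1..} \<and> is_frame ({1..} - J) f}"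

definition synthesis :: "(nat \<Rightarrow> ell2) \<Rightarrow> ell2 \<Rightarrow> ell2" where
  "synthesis f c = (\<Sum>k. coord c (Suc k) *\<^sub>c f (Suc k))"

text \<open>The adjoint with respect to the complex inner product.\<close>

definition cadjoint :: "(ell2 \<Rightarrow> ell2) \<Rightarrow> ell2 \<Rightarrow> ell2" where
  "cadjoint G = (THE W. \<forall>x y. cinner (G x) y = cinner x (W y))"

definition frame_op :: "(nat \<Rightarrow> ell2) \<Rightarrow> ell2 \<Rightarrow> ell2" where
  "frame_op f = synthesis f \<circ> cadjoint (synthesis f)"

end

theory Submission
  imports Defs
begin

text \<open>
  Applying \<open>T^(\<alpha> k)\<close> to \<open>\<phi>\<close> turns the summands with \<open>n > k\<close> into \<open>U^(\<alpha> n - \<alpha> k) f\<^sub>n\<close>, which are small by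
  the geometric weights, reproduces \<open>f\<^sub>k\<close>, and cuts off all but the tails of those with \<open>n < k\<close>, which are small by the
  exponential decay of \<open>f\<^sub>n\<close>.  The choice of \<open>\<alpha>\<close> makes the error family \<open>f\<^sub>k - g\<^sub>k\<close> square summable with
  sum at most \<open>\<epsilon> < A\<close>, so the synthesis operators satisfy \<open>\<parallel>V - V'\<parallel> \<le> \<epsilon>\<^sup>1\<^sup>/\<^sup>2 < A\<^sup>1\<^sup>/\<^sup>2\<close>, and the bounds follow.
  For the excess, removing the finite index set \<open>J\<close> leaves a frame iff the
  coordinates in \<open>J\<close> map \<open>ker V\<close> onto \<open>\<complex>\<^sup>J\<close>, so the excess depends only on the dimension of the kernel; and
  the kernels of \<open>V\<close> and \<open>V'\<close> embed into each other, because a right inverse \<open>R\<close> of \<open>V\<close>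
  of norm at most \<open>A\<^sup>-\<^sup>1\<^sup>/\<^sup>2\<close> makes \<open>V' R\<close> invertible.
\<close>

section \<open>Coercive operators\<close>

text \<open>For small \<open>t > 0\<close> the map \<open>x \<mapsto> x - t (S x - y)\<close> is a contraction.\<close>

lemma coercive_bij:
  fixes S :: "'a :: {real_inner, complete_space} \<Rightarrow> 'a"
  assumes S: "bounded_linear S" and a: "0 < a"
    and coercive: "\<And>x. a * (norm x)\<^sup>2 \<le> inner (S x) x"
  shows "bij S" "bounded_linear (inv S)" "norm (inv S y) \<le> norm y / a"
proof -
  interpret S: bounded_linear S by fact
  have lower: "a * norm x \<le> norm (S x)" for x
  proof (cases "x = 0")
    case False
    have "a * norm x * norm x \<le> norm (S x) * norm x"
      using coercive[of x] norm_cauchy_schwarz[of "S x" x]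
      by (simp add: power2_eq_square mult.assoc)
    then show ?thesis using False by simp
  qed simp
  have inj: "inj S"
  proof (rule injI)
    fix x y assume "S x = S y"
    then have "S (x - y) = 0" by (simp add: S.diff)
    then show "x = y" using lower[of "x - y"] a by (simp add: mult_le_0_iff)
  qed
  obtain b where b: "b > 0" "\<And>x. norm (S x) \<le> norm x * b"
    using S.pos_bounded by blast
  \<comment> \<open>This \<open>t\<close> minimises
    \<open>1 - 2 * t * a + t\<^sup>2 * (a + b)\<^sup>2\<close>, the factor in the estimate of the
    squared norm below, and \<open>c\<^sup>2\<close> is the minimum. Bounding \<open>S\<close> by
    \<open>a + b\<close> makes the radicand nonnegative without comparing \<open>a\<close> and
    \<open>b\<close>.\<close>
  define t where "t = a / (a + b)\<^sup>2"
  define c where "c = sqrt (1 - a\<^sup>2 / (a + b)\<^sup>2)"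
  have t: "t > 0" using a b by (simp add: t_def)
  have "a\<^sup>2 \<le> (a + b)\<^sup>2" using a b by (intro power_mono) auto
  then have c: "0 \<le> c" "c < 1" "c\<^sup>2 = 1 - a\<^sup>2 / (a + b)\<^sup>2"
    using a b by (auto simp: c_def divide_simps)
  have contr: "norm (x - t *\<^sub>R S x) \<le> c * norm x" for x
  proof -
    have "(norm (x - t *\<^sub>R S x))\<^sup>2 = (norm x)\<^sup>2 - 2 * t * inner (S x) x + t\<^sup>2 * (norm (S x))\<^sup>2"
      unfolding power2_norm_eq_inner
      by (simp add: inner_diff_left inner_diff_right inner_commute power2_eq_square algebra_simps)
    also have "\<dots> \<le> (norm x)\<^sup>2 - 2 * t * (a * (norm x)\<^sup>2) + t\<^sup>2 * ((a + b) * norm x)\<^sup>2"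
    proof -
      have "norm (S x) \<le> norm x * b" by (rule b)
      also have "\<dots> \<le> (a + b) * norm x" using a by (simp add: algebra_simps)
      finally have "(norm (S x))\<^sup>2 \<le> ((a + b) * norm x)\<^sup>2" by (intro power_mono) auto
      then show ?thesis using coercive[of x] t
        by (intro add_mono diff_mono mult_left_mono) auto
    qed
    also have "\<dots> = (c * norm x)\<^sup>2"
    proof -
      define d where "d = (a + b)\<^sup>2"
      have "d > 0" using a b by (simp add: d_def)
      moreover have "t = a / d" by (simp add: t_def d_def)
      ultimately have "t\<^sup>2 * d = a\<^sup>2 / d" "t * a = a\<^sup>2 / d"
        by (simp_all add: power2_eq_square)
      then have "t\<^sup>2 * (d * (norm x)\<^sup>2) = a\<^sup>2 / d * (norm x)\<^sup>2"
        "2 * t * (a * (norm x)\<^sup>2) = 2 * (a\<^sup>2 / d * (norm x)\<^sup>2)"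
        by (metis mult.assoc)+
      moreover have "(c * norm x)\<^sup>2 = (norm x)\<^sup>2 - a\<^sup>2 / d * (norm x)\<^sup>2"
        unfolding power_mult_distrib c d_def[symmetric] by (simp only: left_diff_distrib mult_1)
      ultimately show ?thesis
        unfolding power_mult_distrib[of "a + b"] d_def[symmetric] by linarith
    qed
    finally show ?thesis
      by (rule power2_le_imp_le) (use c in auto)
  qed
  have surj: "\<exists>x. S x = y" for y
  proof -
    have "\<exists>!x. x - t *\<^sub>R (S x - y) = x"
    proof (rule banach_fix_type[OF c(1,2)], intro allI)
      fix x z
      show "dist (x - t *\<^sub>R (S x - y)) (z - t *\<^sub>R (S z - y)) \<le> c * dist x z"
        using contr[of "x - z"] by (simp add: dist_norm S.diff algebra_simps)
    qed
    then show ?thesis using t by auto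
  qed
  show bij: "bij S" using inj surj by (metis bijI surjI)
  have inv: "S (inv S y) = y" for y using bij by (simp add: bij_is_surj surj_f_inv_f)
  show bound: "norm (inv S y) \<le> norm y / a" for y
    using lower[of "inv S y"] a by (simp add: inv field_simps)
  show "bounded_linear (inv S)"
  proof (rule bounded_linear_intro[where K = "1 / a"])
    show "inv S (x + y) = inv S x + inv S y" for x y
      by (rule injD[OF inj]) (simp add: inv S.add)
    show "inv S (r *\<^sub>R x) = r *\<^sub>R inv S x" for r x
      by (rule injD[OF inj]) (simp add: inv S.scaleR)
    show "norm (inv S x) \<le> norm x * (1 / a)" for x using bound[of x] by simp
  qed
qed

section \<open>Complex linear algebra in the sequence space\<close>

text \<open>The type classes only provide the real structure; spans and independence, and so the
  kernel dimensions behind the excess, have to be taken over the complex scalars.\<close>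

global_interpretation cvec: vector_space cscale
  by standard (auto intro!: ell2_eqI simp: algebra_simps)

abbreviation clinear :: "(ell2 \<Rightarrow> ell2) \<Rightarrow> bool" where
  "clinear \<equiv> Vector_Spaces.linear cscale cscale"

lemma clinearI:
  assumes "\<And>x y. F (x + y) = F x + F y" "\<And>c x. F (c *\<^sub>c x) = c *\<^sub>c F x"
  shows "clinear F"
  using assms cvec.vector_space_axioms by (simp add: Vector_Spaces.linear_iff)

lemma clinearD:
  assumes "clinear F"
  shows "F (x + y) = F x + F y" "F (c *\<^sub>c x) = c *\<^sub>c F x" "F (x - y) = F x - F y"
proof -
  interpret Vector_Spaces.linear cscale cscale F by fact
  show "F (x + y) = F x + F y" "F (c *\<^sub>c x) = c *\<^sub>c F x" "F (x - y) = F x - F y"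
    by (auto simp: add scale diff)
qed

lemma clinear_inv:
  assumes F: "clinear F" and "bij F"
  shows "clinear (inv F)"
proof -
  have inv: "F (inv F y) = y" for y using assms by (simp add: bij_is_surj surj_f_inv_f)
  note inj = injD[OF bij_is_inj[OF \<open>bij F\<close>]]
  show ?thesis
    by (rule clinearI; rule inj) (simp_all add: clinearD[OF F] inv)
qed

section \<open>Sesquilinear algebra of the complex inner product\<close>

lemma cinner_cscale_right: "cinner x (c *\<^sub>c y) = cnj c * cinner x y"
  by (metis cinner_commute cinner_cscale_left complex_cnj_mult)

lemma cinner_uminus_left: "cinner (- x) y = - cinner x y"
  using cinner_cscale_left[of "-1" x y] by (simp add: cvec.scale_minus_left)

lemma cinner_diff_left: "cinner (x - y) z = cinner x z - cinner y z"
  using cinner_add_left[of x "- y" z] by (simp add: cinner_uminus_left)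

lemma cinner_diff_right: "cinner x (y - z) = cinner x y - cinner x z"
  by (metis cinner_commute cinner_diff_left complex_cnj_diff)

lemma cinner_zero [simp]: "cinner 0 x = 0" "cinner x 0 = 0"
  by (simp_all add: cinner_def)

lemma cinner_self_norm: "cinner x x = of_real ((norm x)\<^sup>2)"
  by (simp add: cinner_self norm_ell2_sq)

lemma norm_cscale [simp]: "norm (c *\<^sub>c x) = cmod c * norm x"
proof (rule power2_eq_imp_eq)
  have "complex_of_real ((norm (c *\<^sub>c x))\<^sup>2) = c * cnj c * of_real ((norm x)\<^sup>2)"
    by (simp only: cinner_self_norm[symmetric] cinner_cscale_left cinner_cscale_right mult.assoc mult.left_commute)
  also have "\<dots> = of_real ((cmod c * norm x)\<^sup>2)"
    by (simp only: complex_norm_square[symmetric] power_mult_distrib of_real_mult)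
  finally show "(norm (c *\<^sub>c x))\<^sup>2 = (cmod c * norm x)\<^sup>2" using of_real_eq_iff by blast
qed auto

text \<open>Multiplying \<open>x\<close> by a unimodular \<open>c\<close> turns the product into its
  modulus, so the Cauchy-Schwarz inequality of the real inner product applies. For a vanishing
  product any unimodular number serves, here 1.\<close>

lemma cmod_cinner_le: "cmod (cinner x y) \<le> norm x * norm y"
proof -
  define c where "c = (if cinner x y = 0 then 1 else cnj (sgn (cinner x y)))"
  have "cmod c = 1" by (simp add: c_def norm_sgn)
  moreover have "c * cinner x y = of_real (cmod (cinner x y))"
    by (simp add: c_def sgn_eq mult.commute[of "cnj _"] flip: complex_norm_square)
       (simp add: power2_eq_square complex_eq_iff flip: complex_norm_square)
  ultimately have "cmod (cinner x y) = inner (c *\<^sub>c x) y"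
    by (simp add: inner_ell2_def cinner_cscale_left)
  also have "\<dots> \<le> norm (c *\<^sub>c x) * norm y" by (rule norm_cauchy_schwarz)
  finally show ?thesis using \<open>cmod c = 1\<close> by simp
qed

lemma bounded_linear_cinner_left: "bounded_linear (\<lambda>x. cinner x y)"
  by (rule bounded_linear_intro[where K = "norm y"])
     (auto simp: cinner_add_left scaleR_ell2_def cinner_cscale_left cmod_cinner_le scaleR_conv_of_real)

lemma bounded_linear_cscale: "bounded_linear (cscale c)"
  by (rule bounded_linear_intro[where K = "cmod c"])
     (auto simp: cvec.scale_right_distrib scaleR_ell2_def mult.commute)

lemma clinear_scaleR: "clinear F \<Longrightarrow> F (r *\<^sub>R x) = r *\<^sub>R F x"
  by (simp add: scaleR_ell2_def clinearD)

lemma ell2_cinner_eqI: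
  assumes "\<And>x. cinner x y = cinner x z"
  shows "y = z"
proof -
  have "cinner (y - z) (y - z) = 0" using assms by (simp add: cinner_diff_right)
  then show ?thesis by (simp add: cinner_self_norm)
qed

lemma coord_sum: "coord (sum g I) k = (\<Sum>i\<in>I. coord (g i) k)"
  by (induction I rule: infinite_finite_induct) auto

lemma cinner_sum_left: "cinner (sum g I) y = (\<Sum>i\<in>I. cinner (g i) y)"
  by (induction I rule: infinite_finite_induct) (auto simp: cinner_add_left)

lemma coord_ell2_basis: "coord (ell2_basis j) k = (if 1 \<le> k \<and> k = j then 1 else 0)"
  by (simp add: ell2_basis.rep_eq)

lemma cinner_ell2_basis: "j \<ge> 1 \<Longrightarrow> cinner (ell2_basis j) x = cnj (coord x j)"
proof -
  assume "j \<ge> 1"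
  have "(\<lambda>k. coord (ell2_basis j) k * cnj (coord x k)) = (\<lambda>k. if k = j then cnj (coord x j) else 0)"
    using \<open>j \<ge> 1\<close> by (auto simp: coord_ell2_basis)
  then show ?thesis using sums_single[of j "\<lambda>_. cnj (coord x j)"]
    by (simp add: cinner_def sums_iff eq_commute)
qed

lemma summable_coord_Suc [simp]: "summable (\<lambda>k. (cmod (coord x (Suc k)))\<^sup>2)"
  using summable_Suc_iff[of "\<lambda>k. (cmod (coord x k))\<^sup>2"] by simp

lemma norm_ell2_sq_Suc: "(norm x)\<^sup>2 = (\<Sum>k. (cmod (coord x (Suc k)))\<^sup>2)" for x :: ell2
  by (simp add: suminf_split_head[OF summable_coord[of x]] norm_ell2_sq)

section \<open>Analysis and synthesis operators\<close>

definition bessel :: "(nat \<Rightarrow> ell2) \<Rightarrow> real \<Rightarrow> bool" where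
  "bessel f b \<longleftrightarrow> 0 \<le> b \<and> (\<forall>x. summable (\<lambda>k. (cmod (cinner x (f (Suc k))))\<^sup>2) \<and>
     (\<Sum>k. (cmod (cinner x (f (Suc k))))\<^sup>2) \<le> (b * norm x)\<^sup>2)"

definition analysis :: "(nat \<Rightarrow> ell2) \<Rightarrow> ell2 \<Rightarrow> ell2" where
  "analysis f x = Abs_ell2 (\<lambda>k. if k = 0 then 0 else cinner x (f k))"

context
  fixes f :: "nat \<Rightarrow> ell2" and b :: real
  assumes f: "bessel f b"
begin

lemma bessel_nonneg: "0 \<le> b"
  using f by (simp add: bessel_def)

lemma coord_analysis: "coord (analysis f x) k = (if k = 0 then 0 else cinner x (f k))"
proof -
  have "summable (\<lambda>k. (cmod (if k = 0 then 0 else cinner x (f k)))\<^sup>2)"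
    using f by (subst summable_Suc_iff[symmetric]) (simp add: bessel_def)
  then show ?thesis unfolding analysis_def by (subst Abs_ell2_inverse) auto
qed

lemma norm_analysis_sq: "(norm (analysis f x))\<^sup>2 = (\<Sum>k. (cmod (cinner x (f (Suc k))))\<^sup>2)"
  unfolding norm_ell2_sq_Suc coord_analysis by simp

lemma norm_analysis_le: "norm (analysis f x) \<le> b * norm x"
proof (rule power2_le_imp_le)
  show "(norm (analysis f x))\<^sup>2 \<le> (b * norm x)\<^sup>2"
    unfolding norm_analysis_sq using f by (simp add: bessel_def)
qed (simp add: bessel_nonneg)

lemma clinear_analysis: "clinear (analysis f)"
  by (rule clinearI; rule ell2_eqI) (auto simp: coord_analysis cinner_add_left cinner_cscale_left)

lemma bounded_linear_analysis: "bounded_linear (analysis f)"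
  by (rule bounded_linear_intro[where K = b])
     (use clinear_analysis norm_analysis_le in \<open>auto simp: clinearD clinear_scaleR mult.commute\<close>)

text \<open>Duality: with \<open>s\<close> the sum, \<open>cinner s s\<close> is the sum of
  \<open>c k * cinner (f (Suc k)) s\<close>, to which Cauchy-Schwarz over \<open>K\<close> and the
  Bessel inequality at \<open>s\<close> apply; one factor \<open>norm s\<close> then
  cancels.\<close>

lemma bessel_finite_sum:
  assumes "finite K"
  shows "norm (\<Sum>k\<in>K. c k *\<^sub>c f (Suc k)) \<le> b * L2_set (\<lambda>k. cmod (c k)) K"
proof -
  define s where "s = (\<Sum>k\<in>K. c k *\<^sub>c f (Suc k))"
  have sm: "summable (\<lambda>k. (cmod (cinner s (f (Suc k))))\<^sup>2)" using f by (simp add: bessel_def)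
  have "(norm s)\<^sup>2 = cmod (cinner s s)"
    unfolding cinner_self_norm norm_of_real by simp
  also have "cinner s s = (\<Sum>k\<in>K. c k * cinner (f (Suc k)) s)"
    by (simp add: s_def cinner_sum_left cinner_cscale_left)
  also have "cmod \<dots> \<le> (\<Sum>k\<in>K. \<bar>cmod (c k)\<bar> * \<bar>cmod (cinner s (f (Suc k)))\<bar>)"
    by (intro sum_norm_le) (metis abs_norm_cancel cinner_commute complex_mod_cnj norm_mult order_refl)
  also have "\<dots> \<le> L2_set (\<lambda>k. cmod (c k)) K * L2_set (\<lambda>k. cmod (cinner s (f (Suc k)))) K"
    by (rule L2_set_mult_ineq)
  also have "L2_set (\<lambda>k. cmod (cinner s (f (Suc k)))) K \<le> norm (analysis f s)"
    unfolding L2_set_def by (rule real_le_lsqrt)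
      (use assms sm in \<open>auto simp: norm_analysis_sq intro!: sum_le_suminf sum_nonneg\<close>)
  also have "\<dots> \<le> b * norm s" by (rule norm_analysis_le)
  finally have "(norm s)\<^sup>2 \<le> L2_set (\<lambda>k. cmod (c k)) K * (b * norm s)"
    by (simp add: mult_left_mono)
  then have "norm s * norm s \<le> b * L2_set (\<lambda>k. cmod (c k)) K * norm s"
    by (simp add: power2_eq_square mult_ac)
  then have "norm s \<le> b * L2_set (\<lambda>k. cmod (c k)) K"
    using bessel_nonneg by (cases "norm s = 0") auto
  then show ?thesis by (simp add: s_def)
qed

lemma summable_synthesis: "summable (\<lambda>k. coord c (Suc k) *\<^sub>c f (Suc k))"
  unfolding summable_Cauchy
proof (intro allI impI)
  fix e :: real assume e: "0 < e"
  note b = bessel_nonneg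
  \<comment> \<open>The divisor \<open>b + 1\<close> covers \<open>b = 0\<close> and makes the final
    inequality strict.\<close>
  have "0 < (e / (b + 1))\<^sup>2" using e b by simp
  then obtain N where N: "\<And>m n. m \<ge> N \<Longrightarrow>
      norm (\<Sum>k\<in>{m..<n}. (cmod (coord c (Suc k)))\<^sup>2) < (e / (b + 1))\<^sup>2"
    using summable_coord_Suc[of c] unfolding summable_Cauchy by meson
  have "norm (\<Sum>k\<in>{m..<n}. coord c (Suc k) *\<^sub>c f (Suc k)) < e" if "m \<ge> N" for m n
  proof -
    have "L2_set (\<lambda>k. cmod (coord c (Suc k))) {m..<n} \<le> e / (b + 1)"
      unfolding L2_set_def by (rule real_le_lsqrt)
        (use N[OF that, of n] e b in \<open>auto simp: sum_nonneg\<close>)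
    then have "b * L2_set (\<lambda>k. cmod (coord c (Suc k))) {m..<n} \<le> b * (e / (b + 1))"
      using b by (rule mult_left_mono)
    also have "\<dots> < e" using e b by (simp add: field_simps)
    finally show ?thesis
      using bessel_finite_sum[of "{m..<n}" "\<lambda>k. coord c (Suc k)"] by simp
  qed
  then show "\<exists>N. \<forall>m\<ge>N. \<forall>n. norm (\<Sum>k\<in>{m..<n}. coord c (Suc k) *\<^sub>c f (Suc k)) < e" by blast
qed

text \<open>\<open>cinner\<close> is continuous in its first argument and may be applied termwise.
  This identifies \<open>analysis f\<close> as the adjoint of \<open>synthesis f\<close>.\<close>

lemma cinner_synthesis: "cinner (synthesis f c) y = cinner c (analysis f y)"
proof -
  have "cinner (synthesis f c) y = (\<Sum>k. cinner (coord c (Suc k) *\<^sub>c f (Suc k)) y)"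
    unfolding synthesis_def
    by (rule bounded_linear.suminf[OF bounded_linear_cinner_left summable_synthesis])
  also have "\<dots> = (\<Sum>k. coord c (Suc k) * cnj (coord (analysis f y) (Suc k)))"
    by (simp add: coord_analysis cinner_cscale_left flip: cinner_commute)
  also have "\<dots> = cinner c (analysis f y)"
    by (simp add: cinner_def suminf_split_head[OF summable_cinner])
  finally show ?thesis .
qed

lemma norm_synthesis_le: "norm (synthesis f c) \<le> b * norm c"
proof -
  let ?s = "synthesis f c"
  have "norm ?s * norm ?s = cmod (cinner c (analysis f ?s))"
    by (simp add: cinner_self_norm norm_mult power2_eq_square flip: cinner_synthesis)
  also have "\<dots> \<le> norm c * norm (analysis f ?s)" by (rule cmod_cinner_le)
  also have "\<dots> \<le> norm c * (b * norm ?s)" by (intro mult_left_mono norm_analysis_le) auto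
  finally show ?thesis using bessel_nonneg by (cases "norm ?s = 0") (auto simp: mult_ac)
qed

lemma clinear_synthesis: "clinear (synthesis f)"
proof (rule clinearI)
  show "synthesis f (x + y) = synthesis f x + synthesis f y" for x y
    unfolding synthesis_def suminf_add[OF summable_synthesis summable_synthesis]
    by (simp add: cvec.scale_left_distrib)
  show "synthesis f (c *\<^sub>c x) = c *\<^sub>c synthesis f x" for c x
    unfolding synthesis_def bounded_linear.suminf[OF bounded_linear_cscale summable_synthesis]
    by simp
qed

lemma bounded_linear_synthesis: "bounded_linear (synthesis f)"
  by (rule bounded_linear_intro[where K = b])
     (use clinear_synthesis norm_synthesis_le in \<open>auto simp: clinearD clinear_scaleR mult.commute\<close>)

lemma cadjoint_synthesis: "cadjoint (synthesis f) = analysis f"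
  unfolding cadjoint_def
proof (rule the_equality)
  fix W assume "\<forall>x y. cinner (synthesis f x) y = cinner x (W y)"
  then show "W = analysis f" by (intro ext ell2_cinner_eqI) (metis cinner_synthesis)
qed (simp add: cinner_synthesis)

lemma frame_op_apply: "frame_op f x = synthesis f (analysis f x)"
  by (simp add: frame_op_def cadjoint_synthesis)

lemma clinear_frame_op: "clinear (frame_op f)"
  using clinear_synthesis clinear_analysis by (intro clinearI) (simp_all add: frame_op_apply clinearD)

lemma bounded_linear_frame_op: "bounded_linear (frame_op f)"
  using bounded_linear_compose[OF bounded_linear_synthesis bounded_linear_analysis]
  by (simp add: frame_op_apply[abs_def])

lemma inner_frame_op: "inner (frame_op f x) x = (norm (analysis f x))\<^sup>2"
  by (simp add: frame_op_apply inner_ell2_def cinner_synthesis cinner_self_norm)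

end

section \<open>Frames\<close>

text \<open>Keeps the index set \<open>{1..}\<close> from being rewritten to \<open>{Suc 0..}\<close>.\<close>

declare One_nat_def [simp del]

text \<open>Passes from the unordered sums over \<open>{1..}\<close> in the definition of frames to
  the series used by the operators; for nonnegative terms the two kinds of summability
  agree.\<close>

lemma infsum_nat_Suc:
  fixes h :: "nat \<Rightarrow> real"
  assumes "\<And>k. 0 \<le> h k"
  shows "h summable_on {1..} \<longleftrightarrow> summable (\<lambda>k. h (Suc k))"
    and "summable (\<lambda>k. h (Suc k)) \<Longrightarrow> infsum h {1..} = (\<Sum>k. h (Suc k))"
proof -
  have bij: "bij_betw Suc UNIV {1..}"
    by (rule bij_betw_byWitness[where f' = "\<lambda>k. k - 1"]) auto
  show "h summable_on {1..} \<longleftrightarrow> summable (\<lambda>k. h (Suc k))"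
    unfolding summable_on_reindex_bij_betw[OF bij, symmetric]
    by (rule summable_on_UNIV_nonneg_real_iff) (rule assms)
  assume "summable (\<lambda>k. h (Suc k))"
  then have "((\<lambda>k. h (Suc k)) has_sum (\<Sum>k. h (Suc k))) UNIV"
    using assms by (intro sums_nonneg_imp_has_sum summable_sums)
  then show "infsum h {1..} = (\<Sum>k. h (Suc k))"
    unfolding infsum_reindex_bij_betw[OF bij, symmetric] by (rule infsumI)
qed

text \<open>Square roots turn the frame inequalities into two-sided norm bounds for the analysis
  operator. The case distinction is there because \<open>norm_analysis_sq\<close> presupposes the
  Bessel property.\<close>

lemma frame_with_bounds_iff:
  "frame_with_bounds {1..} f A B \<longleftrightarrow> 0 < A \<and> 0 < B \<and> bessel f (sqrt B) \<and>
     (\<forall>x. sqrt A * norm x \<le> norm (analysis f x))"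
proof -
  have eq: "frame_with_bounds {1..} f A B \<longleftrightarrow> 0 < A \<and> 0 < B \<and>
      (\<forall>x. summable (\<lambda>k. (cmod (cinner x (f (Suc k))))\<^sup>2) \<and>
        A * (norm x)\<^sup>2 \<le> (\<Sum>k. (cmod (cinner x (f (Suc k))))\<^sup>2) \<and>
        (\<Sum>k. (cmod (cinner x (f (Suc k))))\<^sup>2) \<le> B * (norm x)\<^sup>2)"
    by (simp only: frame_with_bounds_def infsum_nat_Suc zero_le_power2 cong: conj_cong)
  show ?thesis
  proof (cases "0 < A \<and> 0 < B \<and> bessel f (sqrt B)")
    case True
    then have "sqrt A * norm x \<le> norm (analysis f x) \<longleftrightarrow>
        A * (norm x)\<^sup>2 \<le> (\<Sum>k. (cmod (cinner x (f (Suc k))))\<^sup>2)" for x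
      using power_mono_iff[of "sqrt A * norm x" "norm (analysis f x)" 2]
        norm_analysis_sq[of f "sqrt B" x]
      by (simp add: power_mult_distrib)
    then show ?thesis
      using True by (auto simp: eq bessel_def power_mult_distrib)
  qed (auto simp: eq bessel_def power_mult_distrib)
qed

text \<open>Deleted vectors become 0 instead of being renumbered, so a subfamily is again a family
  over \<open>{1..}\<close> and the coordinates keep their meaning.\<close>

definition restrict_family :: "nat set \<Rightarrow> (nat \<Rightarrow> ell2) \<Rightarrow> nat \<Rightarrow> ell2" where
  "restrict_family I f k = (if k \<in> I then f k else 0)"

lemma frame_with_bounds_restrict_family:
  assumes "I \<subseteq> {1..}"
  shows "frame_with_bounds {1..} (restrict_family I f) A B \<longleftrightarrow> frame_with_bounds I f A B"
proof -
  have "(\<lambda>k. (cmod (cinner x (restrict_family I f k)))\<^sup>2) summable_on {1..} \<longleftrightarrow>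
      (\<lambda>k. (cmod (cinner x (f k)))\<^sup>2) summable_on I" for x
    by (rule summable_on_cong_neutral) (use assms in \<open>auto simp: restrict_family_def\<close>)
  moreover have "(\<Sum>\<^sub>\<infinity>k\<in>{1..}. (cmod (cinner x (restrict_family I f k)))\<^sup>2) =
      (\<Sum>\<^sub>\<infinity>k\<in>I. (cmod (cinner x (f k)))\<^sup>2)" for x
    by (rule infsum_cong_neutral) (use assms in \<open>auto simp: restrict_family_def\<close>)
  ultimately show ?thesis by (simp add: frame_with_bounds_def)
qed

section \<open>Invertibility of the frame operator and the canonical dual coefficients\<close>

context
  fixes f :: "nat \<Rightarrow> ell2" and A B :: real
  assumes frame: "frame_with_bounds {1..} f A B"
begin

lemma frame_bessel: "bessel f (sqrt B)"
  using frame by (simp add: frame_with_bounds_iff)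

lemma frame_pos: "0 < A" "0 < B"
  using frame by (simp_all add: frame_with_bounds_iff)

lemma frame_lower: "sqrt A * norm x \<le> norm (analysis f x)"
  using frame by (simp add: frame_with_bounds_iff)

lemma coercive_frame_op: "A * (norm x)\<^sup>2 \<le> inner (frame_op f x) x"
  using power_mono[OF frame_lower[of x], of 2] frame_pos
  by (simp add: inner_frame_op[OF frame_bessel] power_mult_distrib)

lemmas bij_frame_op =
    coercive_bij(1)[OF bounded_linear_frame_op[OF frame_bessel] frame_pos(1) coercive_frame_op]
  and bounded_linear_inv_frame_op =
    coercive_bij(2)[OF bounded_linear_frame_op[OF frame_bessel] frame_pos(1) coercive_frame_op]
  and norm_inv_frame_op_le =
    coercive_bij(3)[OF bounded_linear_frame_op[OF frame_bessel] frame_pos(1) coercive_frame_op]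

lemma frame_op_inv: "frame_op f (inv (frame_op f) y) = y"
  using bij_frame_op by (simp add: bij_is_surj surj_f_inv_f)

lemma clinear_inv_frame_op: "clinear (inv (frame_op f))"
  by (intro clinear_inv clinear_frame_op[OF frame_bessel] bij_frame_op)

text \<open>The canonical right inverse \<open>V\<^sup>* S\<^sup>-\<^sup>1\<close> of the synthesis operator \<open>V\<close>.\<close>

definition dual_analysis :: "ell2 \<Rightarrow> ell2" where
  "dual_analysis y = analysis f (inv (frame_op f) y)"

lemma synthesis_dual_analysis: "synthesis f (dual_analysis y) = y"
  by (simp add: dual_analysis_def frame_op_inv flip: frame_op_apply[OF frame_bessel])

lemma clinear_dual_analysis: "clinear dual_analysis"
  using clinear_analysis[OF frame_bessel] clinear_inv_frame_op
  by (intro clinearI) (simp_all add: dual_analysis_def clinearD)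

text \<open>With \<open>z = inv (frame_op f) y\<close> the squared norm equals
  \<open>inner y z\<close>. Multiplying the bounds of the two factors would only give
  \<open>sqrt B / A\<close>, in general too weak for perturbations of any size
  \<open>e < sqrt A\<close>.\<close>

lemma norm_dual_analysis_le: "norm (dual_analysis y) \<le> norm y / sqrt A"
proof (rule power2_le_imp_le)
  let ?z = "inv (frame_op f) y"
  have "(norm (dual_analysis y))\<^sup>2 = inner y ?z"
    by (simp add: dual_analysis_def frame_op_inv flip: inner_frame_op[OF frame_bessel])
  also have "\<dots> \<le> norm y * norm ?z" by (rule norm_cauchy_schwarz)
  also have "\<dots> \<le> norm y * (norm y / A)" by (intro mult_left_mono norm_inv_frame_op_le) auto
  finally show "(norm (dual_analysis y))\<^sup>2 \<le> (norm y / sqrt A)\<^sup>2"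
    using frame_pos by (simp add: power_divide power2_eq_square)
qed (use frame_pos in auto)

lemma bounded_linear_dual_analysis: "bounded_linear dual_analysis"
  by (rule bounded_linear_intro[where K = "1 / sqrt A"])
     (use clinear_dual_analysis norm_dual_analysis_le in \<open>auto simp: clinearD clinear_scaleR\<close>)

end

section \<open>Excess\<close>

text \<open>For finite \<open>J\<close> and a subspace \<open>K\<close>, the restriction \<open>K \<rightarrow> \<complex>\<^sup>J\<close> of coordinates is onto.\<close>

definition free_coords :: "ell2 set \<Rightarrow> nat set \<Rightarrow> bool" where
  "free_coords K J \<longleftrightarrow>
     (\<exists>u. \<forall>j\<in>J. u j \<in> K \<and> (\<forall>i\<in>J. coord (u j) i = (if i = j then 1 else 0)))"

lemma free_coords_subset: "free_coords K J \<Longrightarrow> J' \<subseteq> J \<Longrightarrow> free_coords K J'"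
  unfolding free_coords_def by blast

text \<open>The \<open>u j\<close> look like unit vectors on \<open>J\<close>: their combinations
  interpolate prescribed coordinates there, and comparing coordinates shows that they are
  independent.\<close>

lemma free_coords_lincomb:
  assumes "finite J" "\<And>j. j \<in> J \<Longrightarrow> (\<forall>i\<in>J. coord (u j) i = (if i = j then 1 else 0))" "i \<in> J"
  shows "coord (\<Sum>j\<in>J. c j *\<^sub>c u j) i = c i"
proof -
  have "coord (\<Sum>j\<in>J. c j *\<^sub>c u j) i = (\<Sum>j\<in>J. if i = j then c j else 0)"
    unfolding coord_sum using assms by (intro sum.cong) auto
  then show ?thesis using assms by simp
qed

text \<open>
  A vector outside the span can be made to vanish on \<open>J\<close>; its remaining nonzero coordinate is adjoined.
\<close>

lemma free_coords_extend:
  assumes K: "cvec.subspace K" and J: "finite J" "J \<subseteq> {1..}"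
    and u: "\<And>j. j \<in> J \<Longrightarrow> u j \<in> K" "\<And>j. j \<in> J \<Longrightarrow> (\<forall>i\<in>J. coord (u j) i = (if i = j then 1 else 0))"
    and x: "x \<in> K" "x \<notin> cvec.span (u ` J)"
  obtains i where "i \<in> {1..} - J" "free_coords K (insert i J)"
proof -
  define z where "z = x - (\<Sum>j\<in>J. coord x j *\<^sub>c u j)"
  have zK: "z \<in> K"
    unfolding z_def using K u(1) x(1)
    by (intro cvec.subspace_diff cvec.subspace_sum cvec.subspace_scale) auto
  have "(\<Sum>j\<in>J. coord x j *\<^sub>c u j) \<in> cvec.span (u ` J)"
    by (intro cvec.span_sum cvec.span_scale cvec.span_base) auto
  then have "z \<noteq> 0" using x(2) by (auto simp: z_def)
  then obtain i where i: "coord z i \<noteq> 0" by (metis coord_zero ell2_eqI)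
  have zJ: "coord z j = 0" if "j \<in> J" for j
    using free_coords_lincomb[OF J(1) u(2) that, of "coord x"] by (simp add: z_def)
  define w where "w = inverse (coord z i) *\<^sub>c z"
  have w: "w \<in> K" "coord w i = 1" "\<And>j. j \<in> J \<Longrightarrow> coord w j = 0"
    using zK K i zJ by (auto simp: w_def cvec.subspace_scale)
  have iJ: "i \<in> {1..} - J" using i zJ by (cases "i = 0") auto
  \<comment> \<open>\<open>w\<close> vanishes on \<open>J\<close>, so subtracting its multiples
    clears the coordinate \<open>i\<close> of the old vectors and keeps their pattern on
    \<open>J\<close>.\<close>
  define u' where "u' j = (if j = i then w else u j - coord (u j) i *\<^sub>c w)" for j
  have "u' j \<in> K" if "j \<in> insert i J" for j
    using that w K u(1) by (auto simp: u'_def intro!: cvec.subspace_diff cvec.subspace_scale)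
  moreover have "coord (u' j) k = (if k = j then 1 else 0)"
    if "j \<in> insert i J" "k \<in> insert i J" for j k
    using that w u(2) iJ by (auto simp: u'_def)
  ultimately have "free_coords K (insert i J)" unfolding free_coords_def by blast
  with iJ that show thesis by blast
qed

text \<open>If all free coordinate sets of \<open>K'\<close> were smaller than \<open>J\<close>,
  there would be a largest one, and by \<open>free_coords_extend\<close> its vectors would span
  \<open>K'\<close>. But \<open>F\<close> carries \<open>card J\<close> independent vectors of
  \<open>K\<close> into \<open>K'\<close>, more than that span allows. A large enough set is finally
  cut down to \<open>card J\<close> elements.\<close>

lemma free_coords_transfer:
  assumes K: "cvec.subspace K" and K': "cvec.subspace K'"
    and F: "clinear F" "inj_on F K" "F ` K \<subseteq> K'"
    and J: "finite J" "free_coords K J"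
  obtains J' where "finite J'" "J' \<subseteq> {1..}" "card J' = card J" "free_coords K' J'"
proof -
  let ?P = "\<lambda>n. \<exists>J'. finite J' \<and> J' \<subseteq> {1..} \<and> card J' = n \<and> free_coords K' J'"
  have "\<exists>n\<ge>card J. ?P n"
  proof (rule ccontr)
    assume neg: "\<not> (\<exists>n\<ge>card J. ?P n)"
    have P0: "?P 0" by (rule exI[of _ "{}"]) (simp add: free_coords_def)
    have bound: "n \<le> card J" if "?P n" for n
      using neg that nat_le_linear by blast
    have max: "?P (Greatest ?P)" "\<And>n. ?P n \<Longrightarrow> n \<le> Greatest ?P"
      using GreatestI_nat[of ?P, OF P0 bound] Greatest_le_nat[of ?P, OF _ bound] by simp_all
    then obtain J' where J': "finite J'" "J' \<subseteq> {1..}" "card J' = Greatest ?P" "free_coords K' J'"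
      by blast
    then obtain u' where u': "\<And>j. j \<in> J' \<Longrightarrow> u' j \<in> K'"
      "\<And>j. j \<in> J' \<Longrightarrow> (\<forall>i\<in>J'. coord (u' j) i = (if i = j then 1 else 0))"
      unfolding free_coords_def by blast
    have span: "K' \<subseteq> cvec.span (u' ` J')"
    proof (rule ccontr)
      assume "\<not> K' \<subseteq> cvec.span (u' ` J')"
      then obtain x where "x \<in> K'" "x \<notin> cvec.span (u' ` J')" by blast
      then obtain i where i: "i \<in> {1..} - J'" "free_coords K' (insert i J')"
        using free_coords_extend[OF K' J'(1,2) u'] by blast
      then have "?P (Suc (Greatest ?P))"
        using J' by (intro exI[of _ "insert i J'"]) auto
      then show False using max(2) by fastforce
    qed
    obtain u where u: "\<And>j. j \<in> J \<Longrightarrow> u j \<in> K"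
      "\<And>j. j \<in> J \<Longrightarrow> (\<forall>i\<in>J. coord (u j) i = (if i = j then 1 else 0))"
      using J(2) unfolding free_coords_def by blast
    have inj_u: "inj_on u J"
      by (rule inj_onI) (metis u(2) zero_neq_one)
    have "cvec.independent (u ` J)"
    proof (rule cvec.independent_if_scalars_zero)
      fix c x assume sum: "(\<Sum>x\<in>u ` J. c x *\<^sub>c x) = 0" and "x \<in> u ` J"
      then obtain i where i: "i \<in> J" "x = u i" by blast
      have "(\<Sum>j\<in>J. c (u j) *\<^sub>c u j) = 0" using sum by (simp add: sum.reindex[OF inj_u])
      then show "c x = 0" using free_coords_lincomb[OF J(1) u(2) i(1), of "\<lambda>j. c (u j)"] i by simp
    qed (use J in auto)
    moreover have "cvec.span (u ` J) \<subseteq> K" using u(1) K by (intro cvec.span_minimal) auto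
    ultimately have "cvec.independent (F ` u ` J)"
      using F(1,2) vector_space_pair.linear_independent_injective_image
        [OF vector_space_pair.intro[OF cvec.vector_space_axioms cvec.vector_space_axioms]]
      by (metis inj_on_subset)
    moreover have "F ` u ` J \<subseteq> cvec.span (u' ` J')" using u(1) F(3) span by blast
    ultimately have "card (F ` u ` J) \<le> card (u' ` J')"
      using J'(1) cvec.independent_span_bound by blast
    moreover have "inj_on F (u ` J)" using F(2) u(1) by (meson image_subsetI inj_on_subset)
    then have "card (F ` u ` J) = card J" by (simp add: card_image inj_u)
    ultimately have "card J \<le> card J'" using card_image_le[OF J'(1), of u'] by simp
    then show False using neg J' by blast
  qed
  then obtain J' where "finite J'" "J' \<subseteq> {1..}" "card J \<le> card J'" "free_coords K' J'" by blast
  moreover from this obtain J'' where "J'' \<subseteq> J'" "card J'' = card J" "finite J''"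
    by (meson obtain_subset_with_card_n)
  ultimately show thesis using that[of J''] free_coords_subset by blast
qed

lemma synthesis_basis: "synthesis f (ell2_basis (Suc j)) = f (Suc j)"
proof -
  have "(\<lambda>k. coord (ell2_basis (Suc j)) (Suc k) *\<^sub>c f (Suc k)) = (\<lambda>k. if k = j then f (Suc k) else 0)"
    by (auto simp: coord_ell2_basis)
  then show ?thesis using sums_single[of j "\<lambda>k. f (Suc k)"]
    by (simp add: synthesis_def sums_iff)
qed

lemma subspace_ker: "clinear F \<Longrightarrow> cvec.subspace {c. F c = 0}"
  using clinearD(3)[of F 0 0] by (auto intro!: cvec.subspaceI simp: clinearD)

text \<open>If the rest is a frame, it expands each removed \<open>f j\<close> with coefficients
  \<open>d j\<close> vanishing on \<open>J\<close>, and the \<open>ell2_basis j - d j\<close> are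
  the required kernel vectors. Conversely, kernel vectors \<open>u j\<close> bound the removed
  analysis coefficients by the remaining ones, so a lower frame bound survives.\<close>

lemma is_frame_remove_iff:
  assumes frame: "frame_with_bounds {1..} f A B" and J: "finite J" "J \<subseteq> {1..}"
  shows "is_frame ({1..} - J) f \<longleftrightarrow> free_coords {c. synthesis f c = 0} J"
proof
  note fb = frame_bessel[OF frame]
  let ?h = "restrict_family ({1..} - J) f"
  {
    assume "is_frame ({1..} - J) f"
    then obtain A' B' where h: "frame_with_bounds {1..} ?h A' B'"
      by (auto simp: is_frame_def frame_with_bounds_restrict_family)
    note hb = frame_bessel[OF h]
    define d where "d j = analysis ?h (inv (frame_op ?h) (f j))" for j
    have dJ: "coord (d j) i = 0" if "i \<in> J" for i j
      using that by (simp add: d_def coord_analysis[OF hb] restrict_family_def)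
    have "synthesis f (d j) = synthesis ?h (d j)" for j
      unfolding synthesis_def using dJ by (intro suminf_cong) (simp add: restrict_family_def)
    also have "synthesis ?h (d j) = f j" for j
      by (simp add: d_def frame_op_inv[OF h] flip: frame_op_apply[OF hb])
    finally have fd: "synthesis f (d j) = f j" for j .
    have "synthesis f (ell2_basis j - d j) = 0" if "j \<in> J" for j
    proof -
      have "j = Suc (j - 1)" using that J by auto
      then have "synthesis f (ell2_basis j) = f j" by (metis synthesis_basis)
      then show ?thesis using fd
        by (simp add: clinearD(3)[OF clinear_synthesis[OF fb]])
    qed
    moreover have "coord (ell2_basis j - d j) i = (if i = j then 1 else 0)"
      if "i \<in> J" "j \<in> J" for i j
      using that J by (auto simp: coord_ell2_basis dJ)
    ultimately show "free_coords {c. synthesis f c = 0} J"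
      unfolding free_coords_def by (intro exI[of _ "\<lambda>j. ell2_basis j - d j"]) auto
  next
    assume "free_coords {c. synthesis f c = 0} J"
    then obtain u where u: "\<And>j. j \<in> J \<Longrightarrow> synthesis f (u j) = 0"
      "\<And>i j. j \<in> J \<Longrightarrow> i \<in> J \<Longrightarrow> coord (u j) i = (if i = j then 1 else 0)"
      unfolding free_coords_def by blast
    have sm: "summable (\<lambda>k. (cmod (cinner x (f (Suc k))))\<^sup>2)" for x
      using fb by (simp add: bessel_def)
    have le: "(cmod (cinner x (?h k)))\<^sup>2 \<le> (cmod (cinner x (f k)))\<^sup>2" for x k
      by (simp add: restrict_family_def)
    have smh: "summable (\<lambda>k. (cmod (cinner x (?h (Suc k))))\<^sup>2)" for x
      by (rule summable_comparison_test'[OF sm[of x], where N = 0]) (use le in auto)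
    have hb: "bessel ?h (sqrt B)"
      unfolding bessel_def
    proof (intro conjI allI smh)
      fix x
      have "(\<Sum>k. (cmod (cinner x (?h (Suc k))))\<^sup>2) \<le> (\<Sum>k. (cmod (cinner x (f (Suc k))))\<^sup>2)"
        by (intro suminf_le sm smh le)
      also have "\<dots> \<le> (sqrt B * norm x)\<^sup>2" using fb by (simp add: bessel_def)
      finally show "(\<Sum>k. (cmod (cinner x (?h (Suc k))))\<^sup>2) \<le> (sqrt B * norm x)\<^sup>2" .
    qed (use frame_pos[OF frame] in simp)
    \<comment> \<open>\<open>M\<close> serves for
      \<open>norm (analysis f x) \<le> M * norm (analysis ?h x)\<close>: 1 for the remaining
      coefficients, \<open>norm (u j)\<close> for each removed one.\<close>
    define M where "M = 1 + (\<Sum>j\<in>J. norm (u j))"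
    have M: "M \<ge> 1" by (simp add: M_def sum_nonneg)
    have split: "analysis f x = analysis ?h x + (\<Sum>j\<in>J. cinner x (f j) *\<^sub>c ell2_basis j)" for x
    proof (rule ell2_eqI)
      fix k
      have "coord (\<Sum>j\<in>J. cinner x (f j) *\<^sub>c ell2_basis j) k = (\<Sum>j\<in>J. if j = k then cinner x (f j) else 0)"
        unfolding coord_sum using J by (intro sum.cong) (auto simp: coord_ell2_basis)
      then show "coord (analysis f x) k = coord (analysis ?h x + (\<Sum>j\<in>J. cinner x (f j) *\<^sub>c ell2_basis j)) k"
        using J by (auto simp: coord_analysis[OF fb] coord_analysis[OF hb] restrict_family_def)
    qed
    text \<open>\<open>u j \<in> ker V\<close> is orthogonal to the analysis coefficients and isolates the \<open>j\<close>-th one.\<close>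
    have coeff: "cmod (cinner x (f j)) \<le> norm (u j) * norm (analysis ?h x)" if j: "j \<in> J" for x j
    proof -
      have "cinner (analysis f x) (u j) = 0"
        using cinner_synthesis[OF fb, of "u j" x] u(1)[OF j] by (metis cinner_commute cinner_zero(1) complex_cnj_zero)
      moreover have "cinner (\<Sum>i\<in>J. cinner x (f i) *\<^sub>c ell2_basis i) (u j)
          = (\<Sum>i\<in>J. if i = j then cinner x (f i) else 0)"
        unfolding cinner_sum_left using J u(2)[OF j]
        by (intro sum.cong) (auto simp: cinner_cscale_left cinner_ell2_basis)
      then have "cinner (\<Sum>i\<in>J. cinner x (f i) *\<^sub>c ell2_basis i) (u j) = cinner x (f j)"
        using j J by simp
      ultimately have "cinner x (f j) = - cinner (analysis ?h x) (u j)"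
        unfolding split cinner_add_left by (metis add.commute add_eq_0_iff)
      then show ?thesis using cmod_cinner_le[of "analysis ?h x" "u j"] by (simp add: mult.commute)
    qed
    have "sqrt A / M * norm x \<le> norm (analysis ?h x)" for x
    proof -
      have "sqrt A * norm x \<le> norm (analysis f x)" by (rule frame_lower[OF frame])
      also have "\<dots> \<le> norm (analysis ?h x) + (\<Sum>j\<in>J. norm (cinner x (f j) *\<^sub>c ell2_basis j))"
        unfolding split by (intro norm_triangle_le add_left_mono norm_sum)
      also have "(\<Sum>j\<in>J. norm (cinner x (f j) *\<^sub>c ell2_basis j)) \<le> (\<Sum>j\<in>J. norm (u j) * norm (analysis ?h x))"
      proof (intro sum_mono)
        fix j assume "j \<in> J"
        moreover have "norm (ell2_basis j) = 1"
        proof -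
          have "1 \<le> j" using \<open>j \<in> J\<close> J by auto
          then have "complex_of_real ((norm (ell2_basis j))\<^sup>2) = 1"
            by (simp only: cinner_self_norm[symmetric] cinner_ell2_basis) (simp add: coord_ell2_basis)
          then have "(norm (ell2_basis j))\<^sup>2 = 1" using of_real_eq_1_iff by blast
          then show ?thesis by (simp add: power2_eq_1_iff) (smt (verit) norm_ge_zero)
        qed
        ultimately show "norm (cinner x (f j) *\<^sub>c ell2_basis j) \<le> norm (u j) * norm (analysis ?h x)"
          using coeff by simp
      qed
      finally have "sqrt A * norm x \<le> M * norm (analysis ?h x)"
        by (simp add: M_def sum_distrib_right algebra_simps)
      then show ?thesis using M by (simp add: field_simps)
    qed
    then have "frame_with_bounds {1..} ?h ((sqrt A / M)\<^sup>2) B"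
      using hb frame_pos[OF frame] M by (simp add: frame_with_bounds_iff)
    then show "is_frame ({1..} - J) f"
      unfolding is_frame_def by (subst (asm) frame_with_bounds_restrict_family) auto
  }
qed

text \<open>By \<open>free_coords_transfer\<close>, an injection of the kernels yields, for every
  set removable from \<open>f\<close>, an equally large one removable from \<open>g\<close>.\<close>

lemma excess_mono:
  assumes f: "frame_with_bounds {1..} f A B" and g: "frame_with_bounds {1..} g A' B'"
    and F: "clinear F" "inj_on F {c. synthesis f c = 0}"
      "F ` {c. synthesis f c = 0} \<subseteq> {c. synthesis g c = 0}"
  shows "excess f \<le> excess g"
  unfolding excess_def
proof (rule Sup_subset_mono, clarify)
  fix J assume J: "finite J" "J \<subseteq> {1..}" "is_frame ({1..} - J) f"
  then have "free_coords {c. synthesis f c = 0} J" by (simp add: is_frame_remove_iff[OF f])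
  then obtain J' where "finite J'" "J' \<subseteq> {1..}" "card J' = card J" "free_coords {c. synthesis g c = 0} J'"
    using free_coords_transfer[OF subspace_ker[OF clinear_synthesis[OF frame_bessel[OF f]]]
        subspace_ker[OF clinear_synthesis[OF frame_bessel[OF g]]] F J(1)] by blast
  then show "\<exists>J'. enat (card J) = enat (card J') \<and> finite J' \<and> J' \<subseteq> {1..} \<and> is_frame ({1..} - J') g"
    using is_frame_remove_iff[OF g] by metis
qed

section \<open>Square-summable perturbations of frames\<close>

context
  fixes f g :: "nat \<Rightarrow> ell2" and A B e :: real
  assumes frame: "frame_with_bounds {1..} f A B"
    and e: "0 \<le> e" "e < sqrt A"
    and pert: "summable (\<lambda>k. (norm (f (Suc k) - g (Suc k)))\<^sup>2)"
      "(\<Sum>k. (norm (f (Suc k) - g (Suc k)))\<^sup>2) \<le> e\<^sup>2"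
begin

interpretation f: bounded_linear "synthesis f"
  by (rule bounded_linear_synthesis[OF frame_bessel[OF frame]])

text \<open>Termwise Cauchy-Schwarz: the square sum of the error norms dominates the squared
  operator norm.\<close>

lemma bessel_pert: "bessel (\<lambda>k. f k - g k) e"
  unfolding bessel_def
proof (intro conjI allI e)
  fix x
  have le: "(cmod (cinner x (f (Suc k) - g (Suc k))))\<^sup>2 \<le> (norm x)\<^sup>2 * (norm (f (Suc k) - g (Suc k)))\<^sup>2" for k
    using power_mono[OF cmod_cinner_le, of x "f (Suc k) - g (Suc k)" 2] by (simp add: power_mult_distrib)
  have sm: "summable (\<lambda>k. (norm x)\<^sup>2 * (norm (f (Suc k) - g (Suc k)))\<^sup>2)"
    by (intro summable_mult pert)
  show sm': "summable (\<lambda>k. (cmod (cinner x (f (Suc k) - g (Suc k))))\<^sup>2)"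
    by (rule summable_comparison_test'[OF sm, where N = 0]) (use le in auto)
  have "(\<Sum>k. (cmod (cinner x (f (Suc k) - g (Suc k))))\<^sup>2)
      \<le> (\<Sum>k. (norm x)\<^sup>2 * (norm (f (Suc k) - g (Suc k)))\<^sup>2)"
    by (intro suminf_le le sm sm')
  also have "\<dots> \<le> (norm x)\<^sup>2 * e\<^sup>2"
    unfolding suminf_mult[OF pert(1)] by (intro mult_left_mono pert) auto
  finally show "(\<Sum>k. (cmod (cinner x (f (Suc k) - g (Suc k))))\<^sup>2) \<le> (e * norm x)\<^sup>2"
    by (simp add: power_mult_distrib mult.commute)
qed

lemma coord_analysis_diff:
  "coord (analysis f x - analysis (\<lambda>k. f k - g k) x) k = (if k = 0 then 0 else cinner x (g k))"
  by (simp add: coord_analysis[OF frame_bessel[OF frame]] coord_analysis[OF bessel_pert] cinner_diff_right)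

text \<open>\<open>coord_analysis\<close> for \<open>g\<close> presupposes what is to be shown, so
  the difference of the two known analysis operators stands in for \<open>analysis g\<close> and
  supplies summability and bound.\<close>

lemma bessel_perturbed: "bessel g (sqrt B + e)"
  unfolding bessel_def
proof (intro conjI allI)
  fix x
  let ?d = "analysis f x - analysis (\<lambda>k. f k - g k) x"
  have coord: "coord ?d (Suc k) = cinner x (g (Suc k))" for k
    by (simp only: coord_analysis_diff) simp
  show "summable (\<lambda>k. (cmod (cinner x (g (Suc k))))\<^sup>2)"
    using summable_coord_Suc[of ?d] unfolding coord .
  have "norm ?d \<le> sqrt B * norm x + e * norm x"
    using norm_triangle_ineq4[of "analysis f x" "analysis (\<lambda>k. f k - g k) x"]
      norm_analysis_le[OF frame_bessel[OF frame], of x] norm_analysis_le[OF bessel_pert, of x] by simp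
  then have "(norm ?d)\<^sup>2 \<le> ((sqrt B + e) * norm x)\<^sup>2"
    by (intro power_mono) (auto simp: algebra_simps)
  then show "(\<Sum>k. (cmod (cinner x (g (Suc k))))\<^sup>2) \<le> ((sqrt B + e) * norm x)\<^sup>2"
    unfolding norm_ell2_sq_Suc coord .
qed (use e frame_pos[OF frame] in auto)

lemma analysis_perturbed: "analysis g x = analysis f x - analysis (\<lambda>k. f k - g k) x"
  by (rule ell2_eqI) (simp only: coord_analysis_diff coord_analysis[OF bessel_perturbed])

lemma frame_perturbed: "frame_with_bounds {1..} g ((sqrt A - e)\<^sup>2) ((sqrt B + e)\<^sup>2)"
  unfolding frame_with_bounds_iff
proof (intro conjI allI)
  have "0 < sqrt A - e" "0 < sqrt B + e"
    using e frame_pos[OF frame] by (auto intro: add_pos_nonneg)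
  then show "0 < (sqrt A - e)\<^sup>2" "0 < (sqrt B + e)\<^sup>2"
    by (auto intro: zero_less_power)
  show "bessel g (sqrt ((sqrt B + e)\<^sup>2))"
    using bessel_perturbed e frame_pos[OF frame] by simp
  fix x
  have "sqrt A * norm x - e * norm x \<le> norm (analysis f x) - norm (analysis (\<lambda>k. f k - g k) x)"
    by (intro diff_mono frame_lower[OF frame] norm_analysis_le[OF bessel_pert])
  also have "\<dots> \<le> norm (analysis g x)"
    unfolding analysis_perturbed by (rule norm_triangle_ineq2)
  finally show "sqrt ((sqrt A - e)\<^sup>2) * norm x \<le> norm (analysis g x)"
    using e by (simp add: left_diff_distrib)
qed

lemma synthesis_diff: "synthesis f c - synthesis g c = synthesis (\<lambda>k. f k - g k) c"
  unfolding synthesis_def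
    suminf_diff[OF summable_synthesis[OF frame_bessel[OF frame]] summable_synthesis[OF bessel_perturbed]]
  by (simp add: cvec.scale_right_diff_distrib)

lemma norm_synthesis_diff_le: "norm (synthesis f c - synthesis g c) \<le> e * norm c"
  unfolding synthesis_diff by (rule norm_synthesis_le[OF bessel_pert])

text \<open>For synthesis operators \<open>V\<close>, \<open>V'\<close> with adjoints
  \<open>W\<close>, \<open>W'\<close>, the splitting
  \<open>V W - V' W' = V (W - W') + (V - V') W'\<close> gives
  \<open>sqrt B * e + e * (sqrt B + e)\<close>.\<close>

lemma norm_frame_op_diff_le: "norm (frame_op f x - frame_op g x) \<le> e * (2 * sqrt B + e) * norm x"
proof -
  have "frame_op f x - frame_op g x = synthesis f (analysis f x - analysis g x)
      + (synthesis f (analysis g x) - synthesis g (analysis g x))"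
    by (simp add: frame_op_apply[OF frame_bessel[OF frame]] frame_op_apply[OF bessel_perturbed] f.diff)
  also have "norm \<dots> \<le> sqrt B * norm (analysis f x - analysis g x) + e * norm (analysis g x)"
    by (intro norm_triangle_le add_mono norm_synthesis_diff_le norm_synthesis_le[OF frame_bessel[OF frame]])
  also have "\<dots> \<le> sqrt B * (e * norm x) + e * ((sqrt B + e) * norm x)"
    using norm_analysis_le[OF bessel_pert, of x] e frame_pos[OF frame]
    by (intro add_mono mult_left_mono norm_analysis_le[OF bessel_perturbed]) (auto simp: analysis_perturbed)
  finally show ?thesis by (simp add: algebra_simps)
qed

text \<open>Resolvent identity: for frame operators \<open>S\<close>, \<open>S'\<close>, the
  difference of the inverses is \<open>S' - S\<close> between \<open>inv S\<close> and
  \<open>inv S'\<close>, which contribute \<open>1 / A\<close> and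
  \<open>1 / (sqrt A - e)\<^sup>2\<close>.\<close>

lemma norm_inv_frame_op_diff_le:
  "norm (inv (frame_op f) x - inv (frame_op g) x)
     \<le> e * (2 * sqrt B + e) / (A * (sqrt A - e)\<^sup>2) * norm x"
proof -
  let ?z = "inv (frame_op g) x"
  have "inv (frame_op f) (frame_op f ?z) = ?z"
    using bij_frame_op[OF frame] by (simp add: bij_is_inj)
  then have "inv (frame_op f) x - ?z = inv (frame_op f) (frame_op g ?z - frame_op f ?z)"
    using clinearD(3)[OF clinear_inv_frame_op[OF frame], of x "frame_op f ?z"]
    by (simp add: frame_op_inv[OF frame_perturbed])
  also have "norm \<dots> \<le> norm (frame_op f ?z - frame_op g ?z) / A"
    by (metis norm_inv_frame_op_le[OF frame] norm_minus_commute)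
  also have "\<dots> \<le> e * (2 * sqrt B + e) * norm ?z / A"
    using frame_pos[OF frame] by (intro divide_right_mono norm_frame_op_diff_le) auto
  also have "\<dots> \<le> e * (2 * sqrt B + e) * (norm x / (sqrt A - e)\<^sup>2) / A"
    using frame_pos[OF frame] e norm_inv_frame_op_le[OF frame_perturbed, of x]
    by (intro divide_right_mono mult_left_mono) auto
  finally show ?thesis by (simp add: mult.commute)
qed

text \<open>
  With \<open>R\<close> the canonical right inverse of \<open>V\<close>, the operator \<open>V' R\<close> is a small perturbation of the
  identity, so \<open>R\<close> is up to an automorphism also a right inverse of \<open>V'\<close>.  Projecting along the
  range of \<open>R\<close> identifies the kernels of \<open>V\<close> and \<open>V'\<close>.
\<close>

lemma excess_perturbed: "excess g = excess f"
proof -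
  note fb = frame_bessel[OF frame] and gb = bessel_perturbed
  let ?V = "synthesis f" and ?V' = "synthesis g" and ?R = "dual_analysis f"
  let ?M = "\<lambda>x. ?V' (?R x)"
  have VR: "?V (?R y) = y" for y by (rule synthesis_dual_analysis[OF frame])
  note linV = clinear_synthesis[OF fb] and linV' = clinear_synthesis[OF gb]
    and linR = clinear_dual_analysis[OF frame]
  have linM: "clinear ?M" using linV' linR by (intro clinearI) (simp_all add: clinearD)
  have blM: "bounded_linear ?M"
    using bounded_linear_compose[OF bounded_linear_synthesis[OF gb] bounded_linear_dual_analysis[OF frame]] .
  have A: "sqrt A > 0" using frame_pos[OF frame] by simp
  \<comment> \<open>\<open>?V\<close> inverts \<open>?R\<close> from the left, so
    \<open>x - ?M x\<close> is the difference of the synthesis operators at \<open>?R x\<close>, of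
    norm at most \<open>e / sqrt A * norm x\<close>.\<close>
  have coercive: "(1 - e / sqrt A) * (norm x)\<^sup>2 \<le> inner (?M x) x" for x
  proof -
    have "norm (x - ?M x) \<le> e * norm (?R x)"
      using norm_synthesis_diff_le[of "?R x"] by (simp add: VR)
    also have "\<dots> \<le> e * (norm x / sqrt A)"
      by (intro mult_left_mono norm_dual_analysis_le[OF frame] e)
    finally have "inner (x - ?M x) x \<le> e * (norm x / sqrt A) * norm x"
      using norm_cauchy_schwarz[of "x - ?M x" x] mult_right_mono[of _ _ "norm x"]
      by (meson norm_ge_zero order_trans)
    then show ?thesis
      by (simp add: inner_diff_left power2_norm_eq_inner[symmetric] power2_eq_square algebra_simps)
  qed
  have "0 < 1 - e / sqrt A" using e A by simp
  then have bijM: "bij ?M" using coercive_bij(1)[OF blM _ coercive] by blast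
  let ?N = "inv ?M"
  have MN: "?V' (?R (?N y)) = y" for y
    using surj_f_inv_f[OF bij_is_surj[OF bijM], of y] .
  note linN = clinear_inv[OF linM bijM]
  \<comment> \<open>\<open>VR\<close> puts the values of \<open>?G\<close> into the kernel of
    \<open>?V\<close>, and \<open>MN\<close> those of \<open>?F\<close> into that of
    \<open>?V'\<close>. Both maps are injective on the kernels because the range of
    \<open>?R\<close> meets each kernel only in 0: for \<open>?V\<close> by \<open>VR\<close>, for
    \<open>?V'\<close> by injectivity of \<open>?M\<close>.\<close>
  let ?F = "\<lambda>x. x - ?R (?N (?V' x))" and ?G = "\<lambda>x. x - ?R (?V x)"
  have "excess f \<le> excess g"
  proof (rule excess_mono[OF frame frame_perturbed])
    show "clinear ?F"
      by (rule clinearI)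
        (simp_all add: clinearD(1,2)[OF linV'] clinearD(1,2)[OF linN] clinearD(1,2)[OF linR] cvec.scale_right_diff_distrib)
    show "inj_on ?F {c. ?V c = 0}"
    proof (rule inj_onI)
      fix x y assume xy: "x \<in> {c. ?V c = 0}" "y \<in> {c. ?V c = 0}" "?F x = ?F y"
      then have R: "x - y = ?R (?N (?V' x) - ?N (?V' y))"
        by (simp add: clinearD(3)[OF linR] algebra_simps)
      then have "?N (?V' x) - ?N (?V' y) = ?V (x - y)" by (simp add: VR)
      also have "\<dots> = 0" using xy by (simp add: f.diff)
      finally show "x = y" using R clinearD(3)[OF linR, of 0 0] by simp
    qed
    show "?F ` {c. ?V c = 0} \<subseteq> {c. ?V' c = 0}"
      by (auto simp: clinearD(3)[OF linV'] MN)
  qed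
  moreover have "excess g \<le> excess f"
  proof (rule excess_mono[OF frame_perturbed frame])
    show "clinear ?G"
      by (rule clinearI)
        (simp_all add: clinearD(1,2)[OF linV] clinearD(1,2)[OF linR] cvec.scale_right_diff_distrib)
    show "inj_on ?G {c. ?V' c = 0}"
    proof (rule inj_onI)
      fix x y assume xy: "x \<in> {c. ?V' c = 0}" "y \<in> {c. ?V' c = 0}" "?G x = ?G y"
      then have R: "x - y = ?R (?V x - ?V y)"
        by (simp add: clinearD(3)[OF linR] algebra_simps)
      then have "?M (?V x - ?V y) = ?V' (x - y)" by simp
      also have "\<dots> = ?M 0"
        using xy clinearD(3)[OF linM, of 0 0] by (simp add: clinearD(3)[OF linV'])
      finally have "?V x - ?V y = 0" using injD[OF bij_is_inj[OF bijM]] by blast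
      then show "x = y" using R clinearD(3)[OF linR, of 0 0] by simp
    qed
    show "?G ` {c. ?V' c = 0} \<subseteq> {c. ?V c = 0}"
      by (auto simp: f.diff VR)
  qed
  ultimately show ?thesis by simp
qed

end

section \<open>Powers of the weighted shifts\<close>

lemma coord_left_shift_pow:
  "coord ((left_shift c ^^ m) x) k = (if k = 0 then 0 else of_real (c ^ m) * coord x (k + m))"
  by (induction m arbitrary: k) (auto simp: left_shift.rep_eq)

lemma coord_right_shift_pow:
  "coord ((right_shift c ^^ m) x) k = (if k \<le> m then 0 else of_real (c ^ m) * coord x (k - m))"
  by (induction m arbitrary: k) (auto simp: right_shift.rep_eq le_diff_conv plus_1_eq_Suc)

lemma clinear_left_shift_pow: "clinear (left_shift c ^^ m)"
  by (rule clinearI; rule ell2_eqI) (auto simp: coord_left_shift_pow algebra_simps)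

lemma norm_left_shift_pow_sq:
  "(norm ((left_shift c ^^ m) x))\<^sup>2 = (\<Sum>k. (\<bar>c\<bar> ^ m * cmod (coord x (Suc k + m)))\<^sup>2)"
  unfolding norm_ell2_sq_Suc coord_left_shift_pow by (simp add: norm_mult norm_power)

lemma bounded_linear_left_shift_pow: "bounded_linear (left_shift c ^^ m)"
proof (rule bounded_linear_intro[where K = "\<bar>c\<bar> ^ m"])
  fix x y :: ell2 and r :: real
  note lin = clinear_left_shift_pow[of m c]
  show "(left_shift c ^^ m) (x + y) = (left_shift c ^^ m) x + (left_shift c ^^ m) y"
    "(left_shift c ^^ m) (r *\<^sub>R x) = r *\<^sub>R (left_shift c ^^ m) x"
    using lin by (simp_all add: clinearD clinear_scaleR)
  have sm: "summable (\<lambda>k. (cmod (coord x (Suc k + m)))\<^sup>2)"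
    using summable_ignore_initial_segment[OF summable_coord[of x], of "Suc m"] by simp
  have "(\<Sum>k. (cmod (coord x (Suc k + m)))\<^sup>2) \<le> (norm x)\<^sup>2"
    using suminf_split_initial_segment[OF summable_coord[of x], of "Suc m"]
    by (simp add: norm_ell2_sq sum_nonneg)
  then have "(norm ((left_shift c ^^ m) x))\<^sup>2 \<le> (norm x * \<bar>c\<bar> ^ m)\<^sup>2"
    unfolding norm_left_shift_pow_sq power_mult_distrib suminf_mult[OF sm]
    by (subst mult.commute) (rule mult_right_mono, auto)
  then show "norm ((left_shift c ^^ m) x) \<le> norm x * \<bar>c\<bar> ^ m"
    by (rule power2_le_imp_le) auto
qed

lemma norm_right_shift_pow: "norm ((right_shift c ^^ m) x) = \<bar>c\<bar> ^ m * norm x"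
proof (rule power2_eq_imp_eq)
  let ?y = "(right_shift c ^^ m) x"
  have "(norm ?y)\<^sup>2 = (\<Sum>k. (cmod (coord ?y (k + m)))\<^sup>2) + (\<Sum>k<m. (cmod (coord ?y k))\<^sup>2)"
    unfolding norm_ell2_sq by (rule suminf_split_initial_segment) simp
  also have "(\<lambda>k. (cmod (coord ?y (k + m)))\<^sup>2) = (\<lambda>k. (\<bar>c\<bar> ^ m)\<^sup>2 * (cmod (coord x k))\<^sup>2)"
    by (rule ext) (simp add: coord_right_shift_pow norm_mult norm_power power_mult_distrib)
  also have "(\<Sum>k<m. (cmod (coord ?y k))\<^sup>2) = 0" by (simp add: coord_right_shift_pow)
  finally show "(norm ?y)\<^sup>2 = (\<bar>c\<bar> ^ m * norm x)\<^sup>2"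
    by (simp add: suminf_mult norm_ell2_sq power_mult_distrib)
qed auto

text \<open>One left shift undoes one right shift, weights included, so the smaller exponent is used
  up.\<close>

lemma left_shift_pow_right_shift_pow:
  assumes "c \<noteq> 0"
  shows "(left_shift c ^^ m) ((right_shift (inverse c) ^^ n) x) =
    (if m \<le> n then (right_shift (inverse c) ^^ (n - m)) x else (left_shift c ^^ (m - n)) x)"
proof (cases "m \<le> n")
  case True
  then obtain d where "n = m + d" using le_Suc_ex by blast
  then show ?thesis
    using assms by (intro ell2_eqI)
      (auto simp: coord_left_shift_pow coord_right_shift_pow power_add power_inverse)
next
  case False
  then obtain d where "m = n + d" using nat_le_linear le_Suc_ex by blast
  then show ?thesis
    using assms False by (intro ell2_eqI)
      (auto simp: coord_left_shift_pow coord_right_shift_pow power_add power_inverse add_ac)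
qed

text \<open>Only the coordinates beyond \<open>m\<close> survive; their squares are dominated by a
  geometric series of ratio \<open>exp (- 2 * \<beta>)\<close>, whence the root in the
  denominator.\<close>

lemma norm_left_shift_pow_decay:
  assumes \<beta>: "\<beta> > 0" and D: "D \<ge> 0"
    and decay: "\<And>j. j > m \<Longrightarrow> cmod (coord x j) \<le> D * exp (- \<beta> * real j)"
  shows "norm ((left_shift c ^^ m) x)
    \<le> \<bar>c\<bar> ^ m * (D * exp (- \<beta> * real (m + 1)) / sqrt (1 - exp (- 2 * \<beta>)))"
proof (rule power2_le_imp_le)
  define E where "E = \<bar>c\<bar> ^ m * (D * exp (- \<beta> * real (m + 1)))"
  let ?q = "exp (- 2 * \<beta>)"
  have q: "?q < 1" using \<beta> by simp
  have le: "(\<bar>c\<bar> ^ m * cmod (coord x (Suc k + m)))\<^sup>2 \<le> E\<^sup>2 * ?q ^ k" for k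
  proof -
    have "\<bar>c\<bar> ^ m * cmod (coord x (Suc k + m)) \<le> \<bar>c\<bar> ^ m * (D * exp (- \<beta> * real (Suc k + m)))"
      by (intro mult_left_mono decay) auto
    also have "\<dots> = E * exp (- \<beta>) ^ k"
      by (simp add: E_def exp_of_nat_mult[symmetric] exp_add[symmetric] algebra_simps)
    finally have "(\<bar>c\<bar> ^ m * cmod (coord x (Suc k + m)))\<^sup>2 \<le> (E * exp (- \<beta>) ^ k)\<^sup>2"
      by (intro power_mono) auto
    also have "\<dots> = E\<^sup>2 * ?q ^ k"
      by (simp add: power_mult_distrib power2_eq_square exp_add[symmetric] flip: power_mult_distrib)
    finally show ?thesis .
  qed
  have sm: "summable (\<lambda>k. E\<^sup>2 * ?q ^ k)" using q by (intro summable_mult summable_geometric) simp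
  have "(norm ((left_shift c ^^ m) x))\<^sup>2 \<le> (\<Sum>k. E\<^sup>2 * ?q ^ k)"
    unfolding norm_left_shift_pow_sq
    by (intro suminf_le le sm summable_comparison_test'[OF sm, where N = 0]) (use le in auto)
  also have "\<dots> = E\<^sup>2 / (1 - ?q)"
    using q by (subst suminf_mult) (auto simp: suminf_geometric summable_geometric)
  also have "\<dots> = (\<bar>c\<bar> ^ m * (D * exp (- \<beta> * real (m + 1)) / sqrt (1 - ?q)))\<^sup>2"
    using q by (simp add: E_def power_mult_distrib power_divide)
  finally show "(norm ((left_shift c ^^ m) x))\<^sup>2
      \<le> (\<bar>c\<bar> ^ m * (D * exp (- \<beta> * real (m + 1)) / sqrt (1 - ?q)))\<^sup>2" .
qed (use D \<beta> in auto)

section \<open>The approximation by the orbit of a single vector\<close>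

definition orbit_vector :: "real \<Rightarrow> (nat \<Rightarrow> ell2) \<Rightarrow> (nat \<Rightarrow> nat) \<Rightarrow> ell2" where
  "orbit_vector lam f \<alpha> = (\<Sum>n. (right_shift (inverse lam) ^^ \<alpha> (Suc n)) (f (Suc n)))"

text \<open>The Bessel inequality at \<open>f k\<close> itself, with only the \<open>k\<close>-th
  coefficient kept.\<close>

lemma norm_frame_le:
  assumes "frame_with_bounds {1..} f A B" "k \<ge> 1"
  shows "norm (f k) \<le> sqrt B"
proof -
  note fb = frame_bessel[OF assms(1)]
  have "(norm (f k))\<^sup>2 = cmod (coord (analysis f (f k)) k)"
    using assms(2) by (simp add: coord_analysis[OF fb] cinner_self_norm norm_power)
  also have "\<dots> \<le> sqrt B * norm (f k)"
    using cmod_coord_le_norm norm_analysis_le[OF fb] order_trans by blast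
  finally show ?thesis
    using bessel_nonneg[OF fb] by (cases "f k = 0") (auto simp: power2_eq_square)
qed

section \<open>Growth of the exponents\<close>

context
  fixes \<alpha> :: "nat \<Rightarrow> nat"
  assumes growth: "\<And>k. k \<ge> 2 \<Longrightarrow> \<alpha> k \<ge> \<alpha> (k - 1) + (k - 2)"
begin

lemma exponent_step: "k \<ge> 1 \<Longrightarrow> \<alpha> (Suc k) \<ge> \<alpha> k + (k - 1)"
  using growth[of "Suc k"] by simp

lemma exponent_mono: "1 \<le> n \<Longrightarrow> n \<le> k \<Longrightarrow> \<alpha> n \<le> \<alpha> k"
proof (induction k)
  case (Suc k)
  then show ?case using exponent_step[of k] by (cases "n = Suc k") auto
qed simp

text \<open>Each step from index 2 on raises the exponent by at least 1; the step from 1 to 2 may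
  leave it unchanged.\<close>

lemma exponent_growth: "2 \<le> m \<Longrightarrow> \<alpha> (i + m) \<ge> \<alpha> m + i"
proof (induction i)
  case (Suc i)
  then show ?case using exponent_step[of "i + m"] by simp
qed simp

text \<open>This is what the growth condition is for: after a left shift by
  \<open>\<alpha> k - \<alpha> n\<close> only coordinates \<open>j \<ge> n\<close> of
  \<open>f n\<close> survive, so the decay bound applies with
  \<open>\<bar>j - n\<bar> = j - n\<close>.\<close>

lemma exponent_gap:
  assumes "1 \<le> n" "n < k"
  shows "n \<le> \<alpha> k - \<alpha> n + 1"
proof -
  have "\<alpha> n \<le> \<alpha> (k - 1)" using assms by (intro exponent_mono) auto
  then show ?thesis using growth[of k] assms by simp
qed

end

lemma norm_right_shift_pow_frame_le:
  assumes "frame_with_bounds {1..} f A B" "lam > 1" "k \<ge> 1"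
  shows "norm ((right_shift (inverse lam) ^^ m) (f k)) \<le> sqrt B * inverse lam ^ m"
  using norm_frame_le[OF assms(1,3)] assms(2)
  by (simp add: norm_right_shift_pow mult.commute mult_right_mono)

lemma geometric_tail_sums:
  fixes lam b :: real
  assumes lam: "lam > 1"
  shows "(\<lambda>n. b * inverse lam ^ (m + n)) sums (lam / (lam - 1) * b * inverse lam ^ m)"
proof -
  have "(\<lambda>n. b * inverse lam ^ m * inverse lam ^ n) sums (b * inverse lam ^ m * (1 / (1 - inverse lam)))"
    using lam by (intro sums_mult geometric_sums) (simp add: inverse_less_1_iff)
  moreover have "1 / (1 - inverse lam) = lam / (lam - 1)" using lam by (simp add: field_simps)
  ultimately show ?thesis by (simp add: power_add mult_ac)
qed

section \<open>Error of the orbit approximation\<close>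

context
  fixes f :: "nat \<Rightarrow> ell2" and A B C \<beta> lam :: real and \<alpha> :: "nat \<Rightarrow> nat"
  assumes frame: "frame_with_bounds {1..} f A B"
    and C: "C > 0" and \<beta>: "\<beta> > 0"
    and decay: "\<forall>j\<ge>1. \<forall>k\<ge>1. cmod (cinner (ell2_basis j) (f k)) \<le> C * exp (- \<beta> * \<bar>real j - real k\<bar>)"
    and lam: "lam > 1"
    and growth: "\<And>k. k \<ge> 2 \<Longrightarrow> \<alpha> k \<ge> \<alpha> (k - 1) + (k - 2)"
begin

text \<open>Since \<open>\<alpha> (Suc n) \<ge> n - 1\<close> and the \<open>f k\<close> are bounded
  by \<open>sqrt B\<close>, a geometric series dominates.\<close>

lemma summable_orbit_vector: "summable (\<lambda>n. (right_shift (inverse lam) ^^ \<alpha> (Suc n)) (f (Suc n)))"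
proof (rule summable_comparison_test'[where N = 1])
  show "summable (\<lambda>n. sqrt B * inverse lam ^ (n - 1))"
    by (subst summable_Suc_iff[symmetric]) (use geometric_tail_sums[OF lam, of "sqrt B" 0] in \<open>simp add: sums_iff\<close>)
  fix n :: nat assume "n \<ge> 1"
  then have "n - 1 \<le> \<alpha> (Suc n)" using exponent_step[OF growth, of n] by simp
  then have "inverse lam ^ \<alpha> (Suc n) \<le> inverse lam ^ (n - 1)"
    using lam by (intro power_decreasing) (auto simp: inverse_le_1_iff)
  then have "sqrt B * inverse lam ^ \<alpha> (Suc n) \<le> sqrt B * inverse lam ^ (n - 1)"
    using frame_pos[OF frame] by (intro mult_left_mono) auto
  with norm_right_shift_pow_frame_le[OF frame lam, of "Suc n" "\<alpha> (Suc n)"]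
  show "norm ((right_shift (inverse lam) ^^ \<alpha> (Suc n)) (f (Suc n))) \<le> sqrt B * inverse lam ^ (n - 1)"
    by simp
qed

text \<open>The shifts collapse to a left shift of \<open>f n\<close> by \<open>m\<close>, and
  \<open>exponent_gap\<close> turns the decay hypothesis into the one-sided bound with constant
  \<open>C * exp (\<beta> * real n)\<close>. The resulting power \<open>r ^ m\<close> is split into
  its parts in \<open>\<alpha> k\<close> and \<open>\<alpha> n\<close>.\<close>

lemma norm_early_term_le:
  assumes n: "1 \<le> n" "n < k"
  shows "norm ((left_shift lam ^^ \<alpha> k) ((right_shift (inverse lam) ^^ \<alpha> n) (f n))) \<le>
    (lam * exp (- \<beta>)) ^ \<alpha> k * (C * exp (- \<beta>) / sqrt (1 - exp (- 2 * \<beta>)) *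
      ((lam * exp (- \<beta>)) powr (- real (\<alpha> n)) * exp (\<beta> * real n)))"
proof -
  have le: "\<alpha> n \<le> \<alpha> k" using exponent_mono[OF growth] n by simp
  define m where "m = \<alpha> k - \<alpha> n"
  define r where "r = lam * exp (- \<beta>)"
  have r: "r > 0" using lam by (simp add: r_def)
  have "(left_shift lam ^^ \<alpha> k) ((right_shift (inverse lam) ^^ \<alpha> n) (f n)) = (left_shift lam ^^ m) (f n)"
    using left_shift_pow_right_shift_pow[of lam "\<alpha> k" "\<alpha> n" "f n"] lam le
    by (cases "\<alpha> k = \<alpha> n") (auto simp: m_def)
  also have "norm \<dots> \<le> \<bar>lam\<bar> ^ m * (C * exp (\<beta> * real n) * exp (- \<beta> * real (m + 1)) / sqrt (1 - exp (- 2 * \<beta>)))"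
  proof (rule norm_left_shift_pow_decay[OF \<beta>])
    fix j assume "m < j"
    then have j: "n \<le> j" "1 \<le> j" using exponent_gap[of \<alpha> n k, OF growth n] by (simp_all add: m_def)
    then have "cmod (coord (f n) j) = cmod (cinner (ell2_basis j) (f n))"
      by (simp add: cinner_ell2_basis)
    also have "\<dots> \<le> C * exp (- \<beta> * \<bar>real j - real n\<bar>)" using decay j n by blast
    also have "\<dots> = C * exp (\<beta> * real n) * exp (- \<beta> * real j)"
      using j by (simp add: exp_add[symmetric] algebra_simps)
    finally show "cmod (coord (f n) j) \<le> C * exp (\<beta> * real n) * exp (- \<beta> * real j)" .
  qed (use C in simp)
  also have "\<dots> = r ^ m * (C * exp (- \<beta>) / sqrt (1 - exp (- 2 * \<beta>)) * exp (\<beta> * real n))"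
    using lam by (simp add: r_def power_mult_distrib exp_of_nat_mult[symmetric] exp_add[symmetric] algebra_simps)
  also have "r ^ m = r ^ \<alpha> k * r powr (- real (\<alpha> n))"
    using r le by (simp add: m_def power_diff powr_minus powr_realpow divide_inverse)
  finally show ?thesis by (simp add: r_def mult_ac)
qed

text \<open>\<open>Suc k\<close> is the index of the vector, so \<open>k = 0\<close>, with an empty
  second sum, covers the first one. The term \<open>p k\<close> reproduces \<open>f (Suc k)\<close>;
  the terms after and before it give the two parts of the bound.\<close>

lemma norm_orbit_diff_le:
  "norm (f (Suc k) - (left_shift lam ^^ \<alpha> (Suc k)) (orbit_vector lam f \<alpha>))
     \<le> lam / (lam - 1) * sqrt B * lam powr (- (real (\<alpha> (k + 2)) - real (\<alpha> (Suc k))))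
       + (lam * exp (- \<beta>)) ^ \<alpha> (Suc k) * (C * exp (- \<beta>) / sqrt (1 - exp (- 2 * \<beta>)) *
          (\<Sum>n = 1..k. (lam * exp (- \<beta>)) powr (- real (\<alpha> n)) * exp (\<beta> * real n)))"
  (is "_ \<le> ?tail + ?head")
proof -
  define a where "a = \<alpha> (Suc k)"
  define p where "p n = (left_shift lam ^^ a) ((right_shift (inverse lam) ^^ \<alpha> (Suc n)) (f (Suc n)))" for n
  note blT = bounded_linear_left_shift_pow[where m = a and c = lam]
  have p: "summable p" "(left_shift lam ^^ a) (orbit_vector lam f \<alpha>) = suminf p"
    unfolding p_def orbit_vector_def using bounded_linear.summable[OF blT summable_orbit_vector]
      bounded_linear.suminf[OF blT summable_orbit_vector] by simp_all
  have pk: "p k = f (Suc k)"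
    using left_shift_pow_right_shift_pow[of lam a a "f (Suc k)"] lam by (simp add: p_def a_def)
  have "suminf p = (\<Sum>n. p (n + Suc k)) + (\<Sum>n<Suc k. p n)"
    by (rule suminf_split_initial_segment[OF p(1)])
  then have "f (Suc k) - (left_shift lam ^^ a) (orbit_vector lam f \<alpha>) = - (\<Sum>n. p (n + Suc k)) - (\<Sum>n<k. p n)"
    by (simp add: p pk)
  also have "norm \<dots> \<le> norm (\<Sum>n. p (n + Suc k)) + norm (\<Sum>n<k. p n)"
    using norm_triangle_ineq4[of "- (\<Sum>n. p (n + Suc k))"] by simp
  also have "norm (\<Sum>n. p (n + Suc k)) \<le> ?tail"
  proof -
    have a: "a \<le> \<alpha> (k + 2)" unfolding a_def by (intro exponent_mono[OF growth]) auto
    let ?d = "\<alpha> (k + 2) - a"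
    note geo = geometric_tail_sums[OF lam, of "sqrt B" ?d]
    have le: "norm (p (n + Suc k)) \<le> sqrt B * inverse lam ^ (?d + n)" for n
    proof -
      \<comment> \<open>As \<open>k + 2 \<ge> 2\<close>, the exponents rise by at least 1 per step
        here, which makes the tail geometric.\<close>
      have g: "\<alpha> (k + 2) + n \<le> \<alpha> (n + (k + 2))" using exponent_growth[OF growth, of "k + 2" n] by simp
      have "p (n + Suc k) = (right_shift (inverse lam) ^^ (\<alpha> (n + (k + 2)) - a)) (f (n + (k + 2)))"
        using left_shift_pow_right_shift_pow[of lam a "\<alpha> (n + (k + 2))" "f (n + (k + 2))"] g a lam
        by (simp add: p_def)
      then have "norm (p (n + Suc k)) \<le> sqrt B * inverse lam ^ (\<alpha> (n + (k + 2)) - a)"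
        using norm_right_shift_pow_frame_le[OF frame lam, of "n + (k + 2)"] by simp
      also have "\<dots> \<le> sqrt B * inverse lam ^ (?d + n)"
        using g a lam frame_pos[OF frame]
        by (intro mult_left_mono power_decreasing) (auto simp: inverse_le_1_iff)
      finally show ?thesis .
    qed
    have sm: "summable (\<lambda>n. norm (p (n + Suc k)))"
      by (rule summable_comparison_test'[OF sums_summable[OF geo], where N = 0]) (use le in auto)
    have "norm (\<Sum>n. p (n + Suc k)) \<le> (\<Sum>n. norm (p (n + Suc k)))" by (rule summable_norm[OF sm])
    also have "\<dots> \<le> (\<Sum>n. sqrt B * inverse lam ^ (?d + n))"
      by (intro suminf_le le sm sums_summable[OF geo])
    also have "\<dots> = lam / (lam - 1) * sqrt B * inverse lam ^ ?d" by (rule sums_unique[OF geo, symmetric])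
    also have "inverse lam ^ ?d = lam powr (- real ?d)"
      using lam by (simp add: powr_minus powr_realpow power_inverse)
    finally show ?thesis using a by (simp add: a_def of_nat_diff)
  qed
  also have "norm (\<Sum>n<k. p n) \<le> (\<Sum>n<k. (lam * exp (- \<beta>)) ^ a * (C * exp (- \<beta>) / sqrt (1 - exp (- 2 * \<beta>)) *
      ((lam * exp (- \<beta>)) powr (- real (\<alpha> (Suc n))) * exp (\<beta> * real (Suc n)))))"
    unfolding p_def a_def by (intro sum_norm_le norm_early_term_le) auto
  also have "\<dots> = ?head"
    by (simp only: a_def sum_distrib_left One_nat_def sum.atLeast1_atMost_eq)
  finally show ?thesis by (simp add: a_def)
qed

text \<open>The two conditions on the exponents make each part of the error at most
  \<open>sqrt \<epsilon> * 2 powr (- (real k / 2 + 1))\<close>, half of what is allowed.\<close>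

lemma norm_orbit_diff_sq_le:
  fixes \<epsilon> :: real
  defines "c \<equiv> C * exp (- \<beta>) / sqrt (1 - exp (- 2 * \<beta>))"
    and "s \<equiv> \<lambda>k. \<Sum>n = 1..k. (lam * exp (- \<beta>)) powr (- real (\<alpha> n)) * exp (\<beta> * real n)"
  assumes \<beta>_lam: "ln lam < \<beta>" and \<epsilon>: "0 < \<epsilon>"
    and tail: "\<And>k. k \<ge> 1 \<Longrightarrow> real (\<alpha> (k + 1)) \<ge> real (\<alpha> k) +
             ((real k / 2 + 1) * ln 2 + ln (lam / (lam - 1)) + ln (sqrt (B / \<epsilon>))) / ln lam"
    and head: "\<And>k. k \<ge> 1 \<Longrightarrow> real (\<alpha> (k + 1)) \<ge>
             ((real k / 2 + 3 / 2) * ln 2 + ln (s k) + ln c - ln (sqrt \<epsilon>)) / (\<beta> - ln lam)"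
    and k: "k \<ge> 1"
  shows "(norm (f k - (left_shift lam ^^ \<alpha> k) (orbit_vector lam f \<alpha>)))\<^sup>2 \<le> \<epsilon> * 2 powr (- real k)"
proof -
  obtain i where i: "k = Suc i" using k by (cases k) auto
  have B: "B > 0" by (rule frame_pos[OF frame])
  have c: "c > 0" using C \<beta> by (simp add: c_def)
  let ?h = "sqrt \<epsilon> * 2 powr (- (real k / 2 + 1))"
  have "lam / (lam - 1) * sqrt B * lam powr (- (real (\<alpha> (k + 1)) - real (\<alpha> k))) \<le> ?h"
  proof -
    have "(real k / 2 + 1) * ln 2 + ln (lam / (lam - 1)) + ln (sqrt (B / \<epsilon>))
        \<le> (real (\<alpha> (k + 1)) - real (\<alpha> k)) * ln lam"
      using tail[OF k] lam by (simp add: field_simps)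
    then have "lam powr (- (real (\<alpha> (k + 1)) - real (\<alpha> k)))
        \<le> exp (- ((real k / 2 + 1) * ln 2 + ln (lam / (lam - 1)) + ln (sqrt (B / \<epsilon>))))"
      using lam by (simp add: powr_def algebra_simps)
    also have "\<dots> = 2 powr (- (real k / 2 + 1)) * inverse (lam / (lam - 1)) * inverse (sqrt (B / \<epsilon>))"
    proof -
      have "exp (ln (lam / (lam - 1))) = lam / (lam - 1)" "exp (ln (sqrt (B / \<epsilon>))) = sqrt (B / \<epsilon>)"
        using lam B \<epsilon> by (auto intro!: exp_ln)
      then show ?thesis
        by (simp only: minus_add_distrib exp_add exp_minus[of "ln _"] powr_def)
           (simp add: ring_distribs)
    qed
    finally have "lam / (lam - 1) * sqrt B * lam powr (- (real (\<alpha> (k + 1)) - real (\<alpha> k)))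
       \<le> lam / (lam - 1) * sqrt B * (2 powr (- (real k / 2 + 1)) * inverse (lam / (lam - 1)) * inverse (sqrt (B / \<epsilon>)))"
      using lam B by (intro mult_left_mono) auto
    also have "\<dots> = ?h" using lam B \<epsilon> by (simp add: real_sqrt_divide field_simps)
    finally show ?thesis .
  qed
  \<comment> \<open>The sum stops at \<open>i = k - 1\<close>, so the condition on
    \<open>\<alpha> (i + 1)\<close> is used, and \<open>i / 2 + 3 / 2 = k / 2 + 1\<close>. For
    \<open>i = 0\<close> the sum is empty and the left side is 0; otherwise \<open>s i\<close> is
    positive and its logarithm is genuine.\<close>
  moreover have "(lam * exp (- \<beta>)) ^ \<alpha> k * (c * s i) \<le> ?h"
  proof (cases "i = 0")
    case False
    have "(lam * exp (- \<beta>)) powr (- real (\<alpha> n)) * exp (\<beta> * real n) > 0" for n using lam by simp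
    then have s: "s i > 0" unfolding s_def using False by (intro sum_pos) auto
    have "(real k / 2 + 1) * ln 2 + ln (s i) + ln c - ln (sqrt \<epsilon>) \<le> real (\<alpha> k) * (\<beta> - ln lam)"
      using head[of i] False \<beta>_lam by (simp add: i field_simps plus_1_eq_Suc)
    then have "exp (- (real (\<alpha> k) * (\<beta> - ln lam)))
        \<le> exp (- ((real k / 2 + 1) * ln 2 + ln (s i) + ln c - ln (sqrt \<epsilon>)))" by simp
    also have "\<dots> = ?h / (s i * c)"
    proof -
      have "exp (ln (s i)) = s i" "exp (ln c) = c" "exp (ln (sqrt \<epsilon>)) = sqrt \<epsilon>"
        using s c \<epsilon> by (auto intro!: exp_ln)
      moreover have "exp (- (L + a + b - d)) = exp d * exp (- L) / (exp a * exp b)" for L a b d :: real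
        by (simp add: exp_minus exp_diff exp_add field_simps)
      moreover have "2 powr (- (real k / 2 + 1)) = exp (- ((real k / 2 + 1) * ln 2))"
        by (simp only: powr_def mult_minus_left) simp
      ultimately show ?thesis by (simp only:)
    qed
    also have "exp (- (real (\<alpha> k) * (\<beta> - ln lam))) = (lam * exp (- \<beta>)) ^ \<alpha> k"
    proof -
      have "exp (ln lam - \<beta>) = lam * exp (- \<beta>)" using lam by (simp add: exp_diff exp_minus field_simps)
      then show ?thesis by (metis exp_of_nat_mult minus_diff_eq mult_minus_right)
    qed
    finally show ?thesis using s c by (simp add: field_simps)
  qed (use \<epsilon> in \<open>simp add: s_def\<close>)
  moreover have "i + 2 = k + 1" by (simp add: i)
  note norm_orbit_diff_le[of i, unfolded this i[symmetric], folded c_def s_def]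
  ultimately have "norm (f k - (left_shift lam ^^ \<alpha> k) (orbit_vector lam f \<alpha>)) \<le> ?h + ?h"
    unfolding s_def by linarith
  also have "\<dots> = sqrt \<epsilon> * 2 powr (- (real k / 2))"
    using powr_diff[of 2 "- (real k / 2)" 1] by simp
  finally have "(norm (f k - (left_shift lam ^^ \<alpha> k) (orbit_vector lam f \<alpha>)))\<^sup>2 \<le> (sqrt \<epsilon> * 2 powr (- (real k / 2)))\<^sup>2"
    by (intro power_mono) auto
  also have "\<dots> = \<epsilon> * 2 powr (- real k)"
    using \<epsilon> powr_add[of 2 "- (real k / 2)" "- (real k / 2)"]
    by (simp add: power_mult_distrib power2_eq_square[of "_ powr _"])
  finally show ?thesis .
qed

end

section \<open>Summation of the errors and the form of the constants\<close>

lemma sum_geometric_half_le: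
  fixes h :: "nat \<Rightarrow> real"
  assumes h: "\<And>k. 0 \<le> h k" "\<And>k. k \<ge> 1 \<Longrightarrow> h k \<le> c * 2 powr (- real k)"
  shows "summable (\<lambda>k. h (Suc k))" "(\<Sum>k. h (Suc k)) \<le> c"
proof -
  have geo: "(\<lambda>k. c * (1 / 2) ^ Suc k) sums (c * 1)"
    by (intro sums_mult power_half_series)
  have "2 powr (- real k) = (1 / 2 :: real) ^ k" for k
    by (simp only: powr_minus powr_realpow[of 2] power_one_over inverse_eq_divide)
  then have le: "h (Suc k) \<le> c * (1 / 2) ^ Suc k" for k
    using h(2)[of "Suc k"] by (simp del: of_nat_Suc power_Suc)
  show sm: "summable (\<lambda>k. h (Suc k))"
    by (rule summable_comparison_test'[OF sums_summable[OF geo], where N = 0]) (use le h(1) in auto)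
  show "(\<Sum>k. h (Suc k)) \<le> c"
    using suminf_le[OF le sm sums_summable[OF geo]] sums_unique[OF geo] by simp
qed

text \<open>Rewrites the stated constants into those of the perturbation lemmas with
  \<open>e = sqrt \<epsilon>\<close>.\<close>

lemma frame_bound_sqrt:
  fixes A B \<epsilon> :: real
  assumes "0 < A" "0 < B" "0 < \<epsilon>"
  shows "A * (1 - sqrt (\<epsilon> / A))\<^sup>2 = (sqrt A - sqrt \<epsilon>)\<^sup>2"
    and "B * (1 + sqrt (\<epsilon> / B))\<^sup>2 = (sqrt B + sqrt \<epsilon>)\<^sup>2"
    and "sqrt (\<epsilon> * B) * (2 + sqrt (\<epsilon> / B)) = sqrt \<epsilon> * (2 * sqrt B + sqrt \<epsilon>)"
proof -
  have "A * (1 - sqrt (\<epsilon> / A))\<^sup>2 = (sqrt A * (1 - sqrt (\<epsilon> / A)))\<^sup>2"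
    using assms by (simp add: power_mult_distrib)
  then show "A * (1 - sqrt (\<epsilon> / A))\<^sup>2 = (sqrt A - sqrt \<epsilon>)\<^sup>2"
    using assms by (simp add: real_sqrt_divide right_diff_distrib)
  have "B * (1 + sqrt (\<epsilon> / B))\<^sup>2 = (sqrt B * (1 + sqrt (\<epsilon> / B)))\<^sup>2"
    using assms by (simp add: power_mult_distrib)
  then show "B * (1 + sqrt (\<epsilon> / B))\<^sup>2 = (sqrt B + sqrt \<epsilon>)\<^sup>2"
    using assms by (simp add: real_sqrt_divide distrib_left)
  show "sqrt (\<epsilon> * B) * (2 + sqrt (\<epsilon> / B)) = sqrt \<epsilon> * (2 * sqrt B + sqrt \<epsilon>)"
    using assms by (simp add: real_sqrt_mult real_sqrt_divide field_simps)
qed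

text \<open>The \<open>bounded_linear\<close> clauses make \<open>onorm\<close> a genuine operator
  norm, and the \<open>bij\<close> clauses make \<open>inv\<close> a genuine inverse.\<close>

theorem theorem2p10:
  fixes f :: "nat \<Rightarrow> ell2" and T U :: "ell2 \<Rightarrow> ell2" and A B C \<beta> lam :: real
  assumes frame: "frame_with_bounds {1..} f A B"
    and C: "C > 0" and \<beta>: "\<beta> > 0"
    and decay: "\<forall>j\<ge>1. \<forall>k\<ge>1. cmod (cinner (ell2_basis j) (f k)) \<le> C * exp (- \<beta> * \<bar>real j - real k\<bar>)"
    and lam: "lam > 1"
    and T: "T = left_shift lam"
    and U: "U = right_shift (inverse lam)"
  shows
    "(\<forall>\<alpha> :: nat \<Rightarrow> nat.
        mono_on {1..} \<alpha> \<and> \<alpha> 1 = 0 \<and> (\<forall>k\<ge>2. \<alpha> k \<ge> \<alpha> (k - 1) + (k - 2)) \<longrightarrow>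
        summable (\<lambda>n. (U ^^ \<alpha> (Suc n)) (f (Suc n))) \<and>
        (let \<phi> = (\<Sum>n. (U ^^ \<alpha> (Suc n)) (f (Suc n))) in
          norm (f 1 - (T ^^ \<alpha> 1) \<phi>) \<le> lam / (lam - 1) * sqrt B * lam powr (- real (\<alpha> 2)) \<and>
          (\<forall>k\<ge>2. norm (f k - (T ^^ \<alpha> k) \<phi>)
             \<le> lam / (lam - 1) * sqrt B * lam powr (- (real (\<alpha> (k + 1)) - real (\<alpha> k)))
               + (lam * exp (- \<beta>)) ^ \<alpha> k *
                 (C * exp (- \<beta>) / sqrt (1 - exp (- 2 * \<beta>)) *
                  (\<Sum>n = 1..k - 1. (lam * exp (- \<beta>)) powr (- real (\<alpha> n)) * exp (\<beta> * real n))))))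
     \<and>
     (\<forall>(\<epsilon> :: real) (\<alpha> :: nat \<Rightarrow> nat).
        ln lam < \<beta> \<and> 0 < \<epsilon> \<and> \<epsilon> < A \<and> \<alpha> 1 = 0 \<and>
        (\<forall>k\<ge>1.
           real (\<alpha> (k + 1)) \<ge> real (\<alpha> k) + real k - 1 \<and>
           real (\<alpha> (k + 1)) \<ge> real (\<alpha> k) +
             ((real k / 2 + 1) * ln 2 + ln (lam / (lam - 1)) + ln (sqrt (B / \<epsilon>))) / ln lam \<and>
           real (\<alpha> (k + 1)) \<ge>
             ((real k / 2 + 3 / 2) * ln 2
              + ln (\<Sum>n = 1..k. (lam * exp (- \<beta>)) powr (- real (\<alpha> n)) * exp (\<beta> * real n))
              + ln (C * exp (- \<beta>) / sqrt (1 - exp (- 2 * \<beta>)))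
              - ln (sqrt \<epsilon>)) / (\<beta> - ln lam)) \<longrightarrow>
        summable (\<lambda>n. (U ^^ \<alpha> (Suc n)) (f (Suc n))) \<and>
        (let \<phi> = (\<Sum>n. (U ^^ \<alpha> (Suc n)) (f (Suc n)));
             g = (\<lambda>k. (T ^^ \<alpha> k) \<phi>);
             V = synthesis f; V' = synthesis g;
             S = frame_op f; S' = frame_op g in
          (\<forall>k\<ge>1. (norm (f k - g k))\<^sup>2 \<le> \<epsilon> * 2 powr (- real k)) \<and>
          frame_with_bounds {1..} g (A * (1 - sqrt (\<epsilon> / A))\<^sup>2) (B * (1 + sqrt (\<epsilon> / B))\<^sup>2) \<and>
          excess g = excess f \<and>
          bounded_linear V \<and> bounded_linear V' \<and>
          onorm (\<lambda>x. V x - V' x) \<le> sqrt \<epsilon> \<and>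
          bounded_linear S \<and> bounded_linear S' \<and>
          onorm (\<lambda>x. S x - S' x) \<le> sqrt (\<epsilon> * B) * (2 + sqrt (\<epsilon> / B)) \<and>
          bij S \<and> bij S' \<and> bounded_linear (inv S) \<and> bounded_linear (inv S') \<and>
          onorm (\<lambda>x. inv S x - inv S' x)
            \<le> sqrt (\<epsilon> * B) * (2 + sqrt (\<epsilon> / B)) / (A\<^sup>2 * (1 - sqrt (\<epsilon> / A))\<^sup>2)))"
proof (intro conjI allI impI)
  fix \<alpha> :: "nat \<Rightarrow> nat"
  assume \<alpha>: "mono_on {1..} \<alpha> \<and> \<alpha> 1 = 0 \<and> (\<forall>k\<ge>2. \<alpha> k \<ge> \<alpha> (k - 1) + (k - 2))"
  then have \<alpha>1: "\<alpha> 1 = 0" and step: "\<And>k. k \<ge> 2 \<Longrightarrow> \<alpha> k \<ge> \<alpha> (k - 1) + (k - 2)" by auto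
  note hyps = frame C \<beta> decay lam step
  show "summable (\<lambda>n. (U ^^ \<alpha> (Suc n)) (f (Suc n)))"
    unfolding U by (rule summable_orbit_vector[OF hyps])
  have "norm (f 1 - (T ^^ \<alpha> 1) (orbit_vector lam f \<alpha>)) \<le> lam / (lam - 1) * sqrt B * lam powr (- real (\<alpha> 2))"
    using norm_orbit_diff_le[OF hyps, of 0] \<alpha>1 by (simp add: T flip: One_nat_def)
  moreover have "norm (f k - (T ^^ \<alpha> k) (orbit_vector lam f \<alpha>))
       \<le> lam / (lam - 1) * sqrt B * lam powr (- (real (\<alpha> (k + 1)) - real (\<alpha> k)))
         + (lam * exp (- \<beta>)) ^ \<alpha> k * (C * exp (- \<beta>) / sqrt (1 - exp (- 2 * \<beta>)) *
            (\<Sum>n = 1..k - 1. (lam * exp (- \<beta>)) powr (- real (\<alpha> n)) * exp (\<beta> * real n)))"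
    if "k \<ge> 2" for k
  proof -
    have "Suc (k - 1) = k" "k - 1 + 2 = k + 1" using that by auto
    from norm_orbit_diff_le[OF hyps, of "k - 1", unfolded this] show ?thesis unfolding T .
  qed
  ultimately show "let \<phi> = (\<Sum>n. (U ^^ \<alpha> (Suc n)) (f (Suc n))) in
          norm (f 1 - (T ^^ \<alpha> 1) \<phi>) \<le> lam / (lam - 1) * sqrt B * lam powr (- real (\<alpha> 2)) \<and>
          (\<forall>k\<ge>2. norm (f k - (T ^^ \<alpha> k) \<phi>)
             \<le> lam / (lam - 1) * sqrt B * lam powr (- (real (\<alpha> (k + 1)) - real (\<alpha> k)))
               + (lam * exp (- \<beta>)) ^ \<alpha> k *
                 (C * exp (- \<beta>) / sqrt (1 - exp (- 2 * \<beta>)) *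
                  (\<Sum>n = 1..k - 1. (lam * exp (- \<beta>)) powr (- real (\<alpha> n)) * exp (\<beta> * real n))))"
    unfolding Let_def U orbit_vector_def by blast
next
  fix \<epsilon> :: real and \<alpha> :: "nat \<Rightarrow> nat"
  assume \<alpha>: "ln lam < \<beta> \<and> 0 < \<epsilon> \<and> \<epsilon> < A \<and> \<alpha> 1 = 0 \<and>
        (\<forall>k\<ge>1.
           real (\<alpha> (k + 1)) \<ge> real (\<alpha> k) + real k - 1 \<and>
           real (\<alpha> (k + 1)) \<ge> real (\<alpha> k) +
             ((real k / 2 + 1) * ln 2 + ln (lam / (lam - 1)) + ln (sqrt (B / \<epsilon>))) / ln lam \<and>
           real (\<alpha> (k + 1)) \<ge>
             ((real k / 2 + 3 / 2) * ln 2
              + ln (\<Sum>n = 1..k. (lam * exp (- \<beta>)) powr (- real (\<alpha> n)) * exp (\<beta> * real n))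
              + ln (C * exp (- \<beta>) / sqrt (1 - exp (- 2 * \<beta>)))
              - ln (sqrt \<epsilon>)) / (\<beta> - ln lam))"
  then have \<beta>_lam: "ln lam < \<beta>" and \<epsilon>: "0 < \<epsilon>" "\<epsilon> < A" and \<alpha>1: "\<alpha> 1 = 0" by auto
  \<comment> \<open>The first of the three lower bounds is the growth condition, shifted by one
    index and stated over the reals.\<close>
  have step: "\<alpha> k \<ge> \<alpha> (k - 1) + (k - 2)" if "k \<ge> 2" for k
  proof -
    define i where "i = k - 1"
    then have i: "k = i + 1" "i \<ge> 1" "k - 1 = i" using that by auto
    then have "real (\<alpha> (i + 1)) \<ge> real (\<alpha> i) + real i - 1" using \<alpha> by blast
    then have "\<alpha> k + 1 \<ge> \<alpha> i + i" unfolding i(1) by linarith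
    then show ?thesis using i by simp
  qed
  note hyps = frame C \<beta> decay lam step
  show "summable (\<lambda>n. (U ^^ \<alpha> (Suc n)) (f (Suc n)))"
    unfolding U by (rule summable_orbit_vector[OF hyps])
  define g where "g k = (T ^^ \<alpha> k) (orbit_vector lam f \<alpha>)" for k
  have close: "(norm (f k - g k))\<^sup>2 \<le> \<epsilon> * 2 powr (- real k)" if "k \<ge> 1" for k
    unfolding g_def T using \<alpha> that by (intro norm_orbit_diff_sq_le[OF hyps]) auto
  note pos = frame_pos[OF frame]
  have e: "0 \<le> sqrt \<epsilon>" "sqrt \<epsilon> < sqrt A" "(sqrt \<epsilon>)\<^sup>2 = \<epsilon>" using \<epsilon> by auto
  have pert: "summable (\<lambda>k. (norm (f (Suc k) - g (Suc k)))\<^sup>2)"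
    "(\<Sum>k. (norm (f (Suc k) - g (Suc k)))\<^sup>2) \<le> (sqrt \<epsilon>)\<^sup>2"
    using sum_geometric_half_le[of "\<lambda>k. (norm (f k - g k))\<^sup>2" \<epsilon>] close e by auto
  note pert = frame e(1,2) pert
  note g_frame = frame_perturbed[OF pert]
  note eqs = frame_bound_sqrt[OF pos \<epsilon>(1)]
  have "onorm (\<lambda>x. synthesis f x - synthesis g x) \<le> sqrt \<epsilon>"
    by (rule onorm_bound[OF e(1)]) (rule norm_synthesis_diff_le[OF pert])
  moreover have "onorm (\<lambda>x. frame_op f x - frame_op g x) \<le> sqrt (\<epsilon> * B) * (2 + sqrt (\<epsilon> / B))"
    unfolding eqs using pos \<epsilon> by (intro onorm_bound norm_frame_op_diff_le[OF pert]) auto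
  moreover have "onorm (\<lambda>x. inv (frame_op f) x - inv (frame_op g) x)
      \<le> sqrt (\<epsilon> * B) * (2 + sqrt (\<epsilon> / B)) / (A\<^sup>2 * (1 - sqrt (\<epsilon> / A))\<^sup>2)"
  proof -
    have "A\<^sup>2 * (1 - sqrt (\<epsilon> / A))\<^sup>2 = A * (sqrt A - sqrt \<epsilon>)\<^sup>2"
      unfolding eqs[symmetric] by (simp add: power2_eq_square[of A])
    then show ?thesis
      unfolding eqs using pos \<epsilon>
      by (simp only:) (intro onorm_bound norm_inv_frame_op_diff_le[OF pert], auto)
  qed
  moreover have "frame_with_bounds {1..} g (A * (1 - sqrt (\<epsilon> / A))\<^sup>2) (B * (1 + sqrt (\<epsilon> / B))\<^sup>2)"
    unfolding eqs by (rule g_frame)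
  moreover have "\<forall>k\<ge>1. (norm (f k - (T ^^ \<alpha> k) (\<Sum>n. (U ^^ \<alpha> (Suc n)) (f (Suc n)))))\<^sup>2
      \<le> \<epsilon> * 2 powr (- real k)"
    using close by (simp add: g_def orbit_vector_def U)
  moreover note excess_perturbed[OF pert]
    bounded_linear_synthesis[OF frame_bessel[OF frame]] bounded_linear_synthesis[OF frame_bessel[OF g_frame]]
    bounded_linear_frame_op[OF frame_bessel[OF frame]] bounded_linear_frame_op[OF frame_bessel[OF g_frame]]
    bij_frame_op[OF frame] bij_frame_op[OF g_frame]
    bounded_linear_inv_frame_op[OF frame] bounded_linear_inv_frame_op[OF g_frame]
  moreover have "(\<lambda>k. (T ^^ \<alpha> k) (\<Sum>n. (U ^^ \<alpha> (Suc n)) (f (Suc n)))) = g"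
    by (simp add: g_def[abs_def] orbit_vector_def U)
  ultimately show "let \<phi> = (\<Sum>n. (U ^^ \<alpha> (Suc n)) (f (Suc n)));
             g = (\<lambda>k. (T ^^ \<alpha> k) \<phi>);
             V = synthesis f; V' = synthesis g;
             S = frame_op f; S' = frame_op g in
          (\<forall>k\<ge>1. (norm (f k - g k))\<^sup>2 \<le> \<epsilon> * 2 powr (- real k)) \<and>
          frame_with_bounds {1..} g (A * (1 - sqrt (\<epsilon> / A))\<^sup>2) (B * (1 + sqrt (\<epsilon> / B))\<^sup>2) \<and>
          excess g = excess f \<and>
          bounded_linear V \<and> bounded_linear V' \<and>
          onorm (\<lambda>x. V x - V' x) \<le> sqrt \<epsilon> \<and>
          bounded_linear S \<and> bounded_linear S' \<and>
          onorm (\<lambda>x. S x - S' x) \<le> sqrt (\<epsilon> * B) * (2 + sqrt (\<epsilon> / B)) \<and>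
          bij S \<and> bij S' \<and> bounded_linear (inv S) \<and> bounded_linear (inv S') \<and>
          onorm (\<lambda>x. inv S x - inv S' x)
            \<le> sqrt (\<epsilon> * B) * (2 + sqrt (\<epsilon> / B)) / (A\<^sup>2 * (1 - sqrt (\<epsilon> / A))\<^sup>2)"
    unfolding Let_def by (simp only:)
qed

end
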